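(* For every $n\ge2$, $$|\det(M_n)|=\prod_{k=2}^{n}C_{k-1}^{\binom{2n-k-1}{n-1}},$$ where $C_m=\frac{1}{m+1}\binom{2m}{m}$ is the $m$th Catalan number.
   Context: $NC(n)$ is the lattice of noncrossing partitions of $\{1,\dots,n\}$ (no $a<b<c<d$ with $a,c$ in one block and $b,d$ in another) under reverse refinement, with meet $\wedge$ and smallest element $\mathbf{0}_n$ (all singletons); $|NC(n)|=C_n$. The Kreweras complement $\overline{\pi}$ of $\pi\in NC(n)$: with points $1,\bar1,2,\bar2,\dots,n,\bar n$ in cyclic order on a circle, $\overline{\pi}$ is the largest partition $\sigma$ of $\{\bar1,\dots,\bar n\}\cong\{1,\dots,n\}$ such that $\pi\cup\sigma$ is noncrossing. $M_n$ is the $C_n\times C_n$ matrix with rows and columns indexed by $NC(n)$ (in the same order), whose $(\pi,\pi')$ entry is $1$ if $\overline{\pi}\wedge\pi'=\mathbf{0}_n$ and $0$ otherwise. *)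

theory Defs
  imports
    "HOL-Library.Disjoint_Sets"
    "HOL-Algebra.Lattice"
    "Jordan_Normal_Form.Determinant"
begin

definition noncrossing :: "nat set set \<Rightarrow> bool" where
  "noncrossing P \<longleftrightarrow>
     \<not> (\<exists>A\<in>P. \<exists>B\<in>P. A \<noteq> B \<and>
          (\<exists>a b c d. a < b \<and> b < c \<and> c < d \<and> a \<in> A \<and> c \<in> A \<and> b \<in> B \<and> d \<in> B))"

definition NC :: "nat \<Rightarrow> nat set set set" where
  "NC n = {P. partition_on {1..n} P \<and> noncrossing P}"

(* P is below Q iff every block of P is contained in a block of Q. *)
definition NC_lattice :: "nat \<Rightarrow> nat set set gorder" where
  "NC_lattice n = \<lparr>carrier = NC n, eq = (=), le = refines {1..n}\<rparr>"

definition singletons :: "nat \<Rightarrow> nat set set" where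
  "singletons n = (\<lambda>i. {i}) ` {1..n}"

(* The union of a partition P of the points 1, ..., n and a partition S of the barred points.
   The cyclic sequence 1, 1bar, 2, 2bar, ..., n, nbar is numbered 1, 2, ..., 2n, so the point i
   becomes 2i - 1 and its barred copy becomes 2i. *)
definition interleave :: "nat set set \<Rightarrow> nat set set \<Rightarrow> nat set set" where
  "interleave P S = (`) (\<lambda>i. 2 * i - 1) ` P \<union> (`) (\<lambda>i. 2 * i) ` S"

definition kreweras :: "nat \<Rightarrow> nat set set \<Rightarrow> nat set set" where
  "kreweras n P =
     (THE S. partition_on {1..n} S \<and> noncrossing (interleave P S) \<and>
        (\<forall>T. partition_on {1..n} T \<and> noncrossing (interleave P T) \<longrightarrow> refines {1..n} T S))"

(* The list ps enumerates NC n and fixes the common order of the rows and columns. *)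
definition M_matrix :: "nat \<Rightarrow> nat set set list \<Rightarrow> real mat" where
  "M_matrix n ps =
     mat (length ps) (length ps)
       (\<lambda>(i, j). if kreweras n (ps ! i) \<sqinter>\<^bsub>NC_lattice n\<^esub> (ps ! j) = singletons n then 1 else 0)"

definition catalan :: "nat \<Rightarrow> real" where
  "catalan m = 1 / (real m + 1) * real ((2 * m) choose m)"

lemma finite_NC: "finite (NC n)"
  by (rule finite_subset[of _ "Pow (Pow {1..n})"]) (auto simp: NC_def partition_on_def)

end

theory Submission
  imports Defs "HOL-Computational_Algebra.Formal_Power_Series"
begin

text \<open>
  The Kreweras complement permutes the noncrossing partitions, so up to sign the determinant is
  that of the matrix $([x \wedge y = 0])_{x,y}$. By Moebius inversion this matrix is $Z D Z^T$ with
  $Z$ the zeta matrix and $D$ the diagonal matrix of the values $\mu(0, x)$, so its determinant is the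
  product of these. The interval below $x$ is the product of the lattices of its blocks, and
  $\mu(0, x)$ is the product over the blocks of $(-1)^{k-1} C_{k-1}$ for a block of size $k$: the
  generating function $W = \sum_{k \ge 1} (-1)^{k-1} C_{k-1} z^k$ is inverse to $z + z^2$, whereas weighted
  sums $S$ over noncrossing partitions satisfy $S = 1 + W(z S)$. It remains to count the blocks of
  size $k$ in all noncrossing partitions; with $C$ the Catalan series, their generating function is
  $z^k C^{k-1} / \sqrt{1 - 4 z}$.
\<close>

section \<open>Catalan numbers and generating functions\<close>

no_notation vec_index (infixl "$" 100)
unbundle fps_syntax

text \<open>The diagonalization enters through a single property of the weights: summed over all y
  below x, their products over the blocks give 1 if x = 0 and 0 otherwise. Blockwise this is the
  statement S = 1 + z. It drops out of a quadratic equation: with 1 + W = (1 + sqrt(1 + 4 z)) / 2,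
  the relation S = 1 + W(z S) becomes (2 S - 1)^2 = 1 + 4 z S, that is S (S - 1 - z) = 0. The
  obstacle is the recursion behind S = 1 + W(z S). Removing the largest point leaves its block one
  element short, so sums of weights by block size satisfy no closed recursion. A parameter
  \<open>r\<close> therefore remembers how many elements the block of the largest remaining point
  has already lost. The resulting system in \<open>r\<close> is unrolled for products of weights and
  solved explicitly for block counts.\<close>

lemma central_binomial_Suc:
  "real (Suc m) * real ((2 * Suc m) choose Suc m) = 2 * (2 * real m + 1) * real ((2 * m) choose m)"
proof -
  have "2 * Suc m = Suc (2 * m + 1)" by simp
  then have 1: "Suc m * ((2 * Suc m) choose Suc m) = (2 * Suc m) * ((2 * m + 1) choose m)"
    by (simp only: Suc_times_binomial)
  have 2: "((2 * m + 1) choose m) * Suc m = Suc (2 * m) * ((2 * m) choose m)"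
  proof -
    have "2 * m + 1 - m = Suc m" by simp
    then have "(2 * m + 1) choose m = Suc (2 * m) choose Suc m"
      using binomial_symmetric[of m "2 * m + 1"] by simp
    then show ?thesis using Suc_times_binomial_eq[of "2 * m" m] by (simp only:)
  qed
  have h1: "real (Suc m) * real ((2 * Suc m) choose Suc m) = real (2 * Suc m) * real ((2 * m + 1) choose m)"
    using arg_cong[OF 1, of real] by (simp only: of_nat_mult)
  have h2: "real ((2 * m + 1) choose m) * real (Suc m) = real (Suc (2 * m)) * real ((2 * m) choose m)"
    using arg_cong[OF 2, of real] by (simp only: of_nat_mult)
  have "real (Suc m) * real ((2 * Suc m) choose Suc m)
      = 2 * (real ((2 * m + 1) choose m) * real (Suc m))"
    unfolding h1 by (simp only: of_nat_mult) simp
  then show ?thesis unfolding h2 by simp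
qed

lemma catalan_Suc: "(real m + 2) * catalan (Suc m) = 2 * (2 * real m + 1) * catalan m"
proof -
  have "(real m + 2) * catalan (Suc m) = real ((2 * Suc m) choose Suc m)"
    by (simp add: catalan_def field_simps del: binomial_Suc_Suc)
  also have "\<dots> = 2 * (2 * real m + 1) * real ((2 * m) choose m) / (real m + 1)"
    using central_binomial_Suc[of m] by (simp add: field_simps del: binomial_Suc_Suc)
  finally show ?thesis by (simp add: catalan_def)
qed

lemma catalan_pos: "catalan m > 0"
  by (simp add: catalan_def)

section \<open>Binomial series with half-integer exponents\<close>

lemma gbinomial_Suc_rec:
  fixes a :: real
  shows "real (Suc k) * (a gchoose Suc k) = (a - real k) * (a gchoose k)"
  using gbinomial_mult_1[of a k] by (simp add: algebra_simps)

text \<open>The coefficients of (1 - 4 z)^(-1/2) are the central binomial coefficients: both sides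
  satisfy the same first-order recursion, by \<open>gbinomial_Suc_rec\<close> and
  \<open>central_binomial_Suc\<close>.\<close>

lemma gbinomial_neg_half: "(- 4) ^ n * ((- 1 / 2 :: real) gchoose n) = real ((2 * n) choose n)"
proof (induction n)
  case (Suc n)
  have "real (Suc n) * ((- 4) ^ Suc n * ((- 1 / 2 :: real) gchoose Suc n))
      = (- 4) ^ Suc n * ((- 1 / 2 - real n) * ((- 1 / 2) gchoose n))"
    unfolding gbinomial_Suc_rec[of n "- 1 / 2", symmetric] by simp
  also have "\<dots> = 2 * (2 * real n + 1) * ((- 4) ^ n * ((- 1 / 2 :: real) gchoose n))"
    by (simp add: algebra_simps)
  also have "\<dots> = real (Suc n) * real ((2 * Suc n) choose Suc n)"
    unfolding Suc central_binomial_Suc ..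
  finally show ?case
    by (rule mult_left_cancel[THEN iffD1, rotated]) simp
qed simp

text \<open>From degree 1 on, the coefficients of sqrt(1 + 4 z) are twice the signed Catalan numbers
  that serve as Moebius weights; \<open>catalan_Suc\<close> matches the two recursions.\<close>

lemma gbinomial_half:
  "4 ^ Suc n * ((1 / 2 :: real) gchoose Suc n) = 2 * (- 1) ^ n * catalan n"
proof (induction n)
  case 0
  then show ?case by (simp add: catalan_def)
next
  case (Suc n)
  have regroup: "- 2 * s * (k * c) = k * (2 * (- 1 * s) * c)" for s k c :: real by simp
  have "(real n + 2) * (4 ^ Suc (Suc n) * ((1 / 2 :: real) gchoose Suc (Suc n)))
      = 4 ^ Suc (Suc n) * ((1 / 2 - real (Suc n)) * ((1 / 2) gchoose Suc n))"
    unfolding gbinomial_Suc_rec[of "Suc n" "1 / 2", symmetric] by simp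
  also have "\<dots> = (- 2) * (2 * real n + 1) * (4 ^ Suc n * ((1 / 2 :: real) gchoose Suc n))"
    by (simp add: algebra_simps)
  also have "\<dots> = (- 2) * (2 * real n + 1) * (2 * (- 1) ^ n * catalan n)"
    unfolding Suc ..
  also have "\<dots> = - 2 * (- 1) ^ n * (2 * (2 * real n + 1) * catalan n)"
    by (simp only: mult.assoc mult.commute mult.left_commute)
  also have "\<dots> = (real n + 2) * (2 * (- 1) ^ Suc n * catalan (Suc n))"
    unfolding catalan_Suc[of n, symmetric] power_Suc by (rule regroup)
  finally show ?case
    by (rule mult_left_cancel[THEN iffD1, rotated]) simp
qed

text \<open>The series of (1 + c z)^a. Square roots of series are handled through the exponent law
  \<open>binomial_series_mult\<close>, with exponents 1/2 and -1/2.\<close>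

definition binomial_series :: "real \<Rightarrow> real \<Rightarrow> real fps" where
  "binomial_series a c = Abs_fps (\<lambda>n. c ^ n * (a gchoose n))"

lemma binomial_series_mult:
  "binomial_series a c * binomial_series b c = binomial_series (a + b) c"
proof (rule fps_ext)
  fix n
  have "(binomial_series a c * binomial_series b c) $ n
      = (\<Sum>i=0..n. c ^ n * ((a gchoose i) * (b gchoose (n - i))))"
    unfolding fps_mult_nth binomial_series_def fps_nth_Abs_fps
    by (rule sum.cong) (auto simp flip: power_add simp: algebra_simps)
  also have "\<dots> = binomial_series (a + b) c $ n"
    by (simp add: binomial_series_def flip: sum_distrib_left gbinomial_Vandermonde)
  finally show "(binomial_series a c * binomial_series b c) $ n = binomial_series (a + b) c $ n" .
qed

lemma binomial_series_0 [simp]: "binomial_series 0 c = 1"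
  by (rule fps_ext) (auto simp: binomial_series_def gbinomial_0_left)

lemma binomial_series_1: "binomial_series 1 c = 1 + fps_const c * fps_X"
proof (rule fps_ext)
  fix n
  have "(1::real) gchoose n = real (1 choose n)"
    by (metis binomial_gbinomial of_nat_1)
  then show "binomial_series 1 c $ n = (1 + fps_const c * fps_X) $ n"
    by (cases "n = 0 \<or> n = 1") (auto simp: binomial_series_def binomial_eq_0)
qed

section \<open>Weighted sums over noncrossing partitions\<close>

text \<open>
  The sum over noncrossing partitions of an $n$-set of the products of the block weights, where the
  block of the largest point is counted with \<^term>\<open>r\<close> extra elements: these are the larger points
  already removed from it.
\<close>

fun nc_sum :: "(nat \<Rightarrow> real) \<Rightarrow> nat \<Rightarrow> nat \<Rightarrow> real" where
  "nc_sum w r 0 = w r"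
| "nc_sum w r (Suc n) = (\<Sum>i\<le>n. nc_sum w (Suc r) i * nc_sum w 0 (n - i))"

definition nc_fps :: "(nat \<Rightarrow> real) \<Rightarrow> nat \<Rightarrow> real fps" where
  "nc_fps w r = Abs_fps (nc_sum w r)"

lemma nc_fps_rec: "nc_fps w r = fps_const (w r) + fps_X * nc_fps w 0 * nc_fps w (Suc r)"
proof (rule fps_ext)
  fix n
  show "nc_fps w r $ n = (fps_const (w r) + fps_X * nc_fps w 0 * nc_fps w (Suc r)) $ n"
  proof (cases n)
    case (Suc m)
    have eq: "fps_X * nc_fps w 0 * nc_fps w (Suc r) = fps_X * (nc_fps w (Suc r) * nc_fps w 0)"
      by (simp only: mult.assoc mult.commute mult.left_commute)
    have "(fps_X * nc_fps w 0 * nc_fps w (Suc r)) $ n = (nc_fps w (Suc r) * nc_fps w 0) $ m"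
      unfolding eq Suc by simp
    also have "\<dots> = nc_sum w r n"
      unfolding fps_mult_nth by (simp add: Suc nc_fps_def atMost_atLeast0)
    finally show ?thesis by (simp add: Suc nc_fps_def)
  qed (simp add: nc_fps_def)
qed

text \<open>Unrolling the recursion in \<open>r\<close> follows the block of the largest point
  downwards: each of its elements contributes a factor \<open>fps_X * nc_fps w 0\<close>, for itself
  and for the points in the gap below it, and \<open>i\<close> is the size at which the block ends.
  Stopping after \<open>N\<close> steps leaves a remainder divisible by the \<open>N\<close>-th
  power of \<open>fps_X\<close>.\<close>

lemma nc_fps_expansion:
  "nc_fps w 0 = (\<Sum>i<N. fps_const (w i) * (fps_X * nc_fps w 0) ^ i)
     + (fps_X * nc_fps w 0) ^ N * nc_fps w N"
proof (induction N)
  case (Suc N)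
  define Y where "Y = fps_X * nc_fps w 0"
  have "Y ^ N * nc_fps w N = fps_const (w N) * Y ^ N + Y ^ Suc N * nc_fps w (Suc N)"
    using nc_fps_rec[of w N] unfolding Y_def[symmetric] by (simp add: algebra_simps)
  with Suc show ?case unfolding Y_def[symmetric] by (simp only: sum.lessThan_Suc add.assoc)
qed simp

text \<open>Expanding up to \<open>Suc n\<close> pushes the remainder beyond degree
  \<open>n\<close>; what is left is the composition, coefficient by coefficient.\<close>

lemma nc_fps_compose: "nc_fps w 0 = Abs_fps w oo (fps_X * nc_fps w 0)"
proof (rule fps_ext)
  fix n
  define Y where "Y = fps_X * nc_fps w 0"
  have "nc_fps w 0 $ n = ((\<Sum>i<Suc n. fps_const (w i) * Y ^ i) + Y ^ Suc n * nc_fps w (Suc n)) $ n"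
    unfolding Y_def by (subst nc_fps_expansion[of w "Suc n"]) simp
  also have "\<dots> = (\<Sum>i<Suc n. w i * (Y ^ i $ n)) + (Y ^ Suc n * nc_fps w (Suc n)) $ n"
    by (simp add: fps_sum_nth)
  also have "(Y ^ Suc n * nc_fps w (Suc n)) $ n = 0"
    unfolding Y_def power_mult_distrib mult.assoc by (simp only: fps_X_power_mult_nth) simp
  finally show "nc_fps w 0 $ n = (Abs_fps w oo (fps_X * nc_fps w 0)) $ n"
    unfolding fps_compose_nth Y_def by (simp add: lessThan_Suc_atMost atMost_atLeast0)
qed

text \<open>For positive \<open>k\<close> this is the Moebius function of the noncrossing partitions
  of a \<open>k\<close>-set, from the smallest to the largest element. The value 1 at 0 serves the
  empty set, whose only partition has an empty product; the series of the weights is thus 1 +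
  W.\<close>

definition moebius_weight :: "nat \<Rightarrow> real" where
  "moebius_weight k = (if k = 0 then 1 else (- 1) ^ (k - 1) * catalan (k - 1))"

lemma moebius_weight_series:
  "fps_const 2 * Abs_fps moebius_weight = 1 + binomial_series (1 / 2) 4"
proof (rule fps_ext)
  fix n show "(fps_const 2 * Abs_fps moebius_weight) $ n = (1 + binomial_series (1 / 2) 4) $ n"
  proof (cases n)
    case (Suc m)
    have "(fps_const 2 * Abs_fps moebius_weight) $ Suc m = 2 * (- 1) ^ m * catalan m"
      by (simp add: moebius_weight_def)
    also have "\<dots> = 4 ^ Suc m * ((1 / 2 :: real) gchoose Suc m)"
      by (rule gbinomial_half[symmetric])
    finally show ?thesis unfolding Suc by (simp add: binomial_series_def)
  qed (simp add: moebius_weight_def binomial_series_def)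
qed

text \<open>Here \<open>H\<close> stands for sqrt(1 + 4 z S), and squaring it gives the quadratic
  equation for S. Series form an integral domain, and the constant term 1 of S rules out the
  solution S = 0.\<close>

lemma nc_fps_moebius: "nc_fps moebius_weight 0 = 1 + fps_X"
proof -
  define S where "S = nc_fps moebius_weight 0"
  define H where "H = binomial_series (1 / 2) 4 oo (fps_X * S)"
  have S0: "S $ 0 = 1" by (simp add: S_def nc_fps_def moebius_weight_def)
  have S: "fps_const 2 * S = 1 + H"
  proof -
    have "fps_const 2 * S = fps_const 2 * (Abs_fps moebius_weight oo (fps_X * S))"
      unfolding S_def by (rule arg_cong[OF nc_fps_compose])
    also have "\<dots> = (fps_const 2 * Abs_fps moebius_weight) oo (fps_X * S)"
      by (simp add: fps_compose_mult_distrib)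
    also have "\<dots> = 1 + H"
      unfolding moebius_weight_series H_def by (simp add: fps_compose_add_distrib)
    finally show ?thesis .
  qed
  have "H * H = (1 + fps_const 4 * fps_X) oo (fps_X * S)"
    unfolding H_def
    by (simp add: binomial_series_mult binomial_series_1 flip: fps_compose_mult_distrib)
  also have "\<dots> = 1 + fps_const 4 * (fps_X * S)"
    by (simp add: fps_compose_add_distrib fps_compose_mult_distrib)
  finally have HH: "H * H = 1 + 4 * (fps_X * S)"
    by (simp only: numeral_fps_const)
  have "H = 2 * S - 1" using S by (simp add: numeral_fps_const)
  then have "(2 * S - 1) * (2 * S - 1) = 1 + 4 * (fps_X * S)" using HH by simp
  then have "4 * (S * (S - 1 - fps_X)) = 0"
    by (simp add: algebra_simps)
  then have "S * (S - 1 - fps_X) = 0" by simp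
  moreover have "S \<noteq> 0" using S0 by auto
  ultimately have "S - 1 - fps_X = 0" by simp
  then show ?thesis unfolding S_def by (simp only: diff_diff_eq right_minus_eq)
qed

lemma nc_sum_moebius: "nc_sum moebius_weight 0 n = (if n \<le> 1 then 1 else 0)"
proof -
  have "nc_sum moebius_weight 0 n = (1 + fps_X) $ n"
    unfolding nc_fps_moebius[symmetric] by (simp add: nc_fps_def)
  then show ?thesis by auto
qed

section \<open>Generating function for the blocks of a given size\<close>

abbreviation nc_count :: "nat \<Rightarrow> real" where
  "nc_count n \<equiv> nc_sum (\<lambda>_. 1) 0 n"

text \<open>This is the derivative of \<open>nc_sum\<close> at the constant weight 1 in the
  direction \<open>f\<close>, hence the product rule in the recursion: the block that is evaluated
  lies in one part, and the other part is only counted.\<close>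

fun block_sum :: "(nat \<Rightarrow> real) \<Rightarrow> nat \<Rightarrow> nat \<Rightarrow> real" where
  "block_sum f r 0 = f r"
| "block_sum f r (Suc n) =
     (\<Sum>i\<le>n. block_sum f (Suc r) i * nc_count (n - i) + nc_count i * block_sum f 0 (n - i))"

lemma nc_sum_const: "nc_sum (\<lambda>_. c) r n = nc_sum (\<lambda>_. c) 0 n"
proof (induction n arbitrary: r rule: less_induct)
  case (less n)
  show ?case
  proof (cases n)
    case (Suc m)
    have "nc_sum (\<lambda>_. c) (Suc r) i = nc_sum (\<lambda>_. c) (Suc 0) i" if "i \<le> m" for i
      using less[of i "Suc r"] less[of i "Suc 0"] that Suc by simp
    then show ?thesis unfolding Suc nc_sum.simps by (intro sum.cong) auto
  qed simp
qed

text \<open>A block that has already lost more than \<open>k\<close> elements cannot have size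
  \<open>k\<close>, so the exact value of \<open>r\<close> beyond \<open>k\<close> does not matter.
  This closes the infinite system of series indexed by \<open>r\<close>.\<close>

lemma block_sum_eventually_const:
  assumes "\<And>r. r > k \<Longrightarrow> f r = 0" "r > k"
  shows "block_sum f r n = block_sum f (Suc r) n"
  using assms(2)
proof (induction n arbitrary: r rule: less_induct)
  case (less n)
  show ?case
  proof (cases n)
    case 0
    then show ?thesis using assms(1) less.prems by simp
  next
    case (Suc m)
    have "block_sum f (Suc r) i = block_sum f (Suc (Suc r)) i" if "i \<le> m" for i
      using less.IH[of i "Suc r"] that Suc less.prems by simp
    then show ?thesis unfolding Suc block_sum.simps by (intro sum.cong) auto
  qed
qed

abbreviation catalan_fps :: "real fps" where
  "catalan_fps \<equiv> nc_fps (\<lambda>_. 1) 0"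

lemma catalan_fps_rec: "catalan_fps = 1 + fps_X * catalan_fps * catalan_fps"
proof -
  have "nc_sum (\<lambda>_. 1) (Suc 0) = nc_sum (\<lambda>_. 1) 0"
    by (rule ext) (rule nc_sum_const)
  then have "nc_fps (\<lambda>_. 1) (Suc 0) = nc_fps (\<lambda>_. 1) 0"
    by (simp only: nc_fps_def)
  then show ?thesis using nc_fps_rec[of "\<lambda>_. 1" 0] by simp
qed

lemma block_sum_fps_rec:
  "Abs_fps (block_sum f r) = fps_const (f r)
     + fps_X * catalan_fps * (Abs_fps (block_sum f (Suc r)) + Abs_fps (block_sum f 0))"
  (is "?L = _ + fps_X * catalan_fps * (?P + ?Q)")
proof (rule fps_ext)
  fix n
  show "?L $ n = (fps_const (f r) + fps_X * catalan_fps * (?P + ?Q)) $ n"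
  proof (cases n)
    case (Suc m)
    have "(fps_X * catalan_fps * (?P + ?Q)) $ n = (?P * catalan_fps + catalan_fps * ?Q) $ m"
      by (simp add: Suc algebra_simps)
    also have "\<dots> = block_sum f r n"
      unfolding fps_add_nth fps_mult_nth
      by (simp add: Suc nc_fps_def atMost_atLeast0 sum.distrib)
    finally show ?thesis by (simp add: Suc)
  qed simp
qed

text \<open>With C the Catalan series these are the series C^j / sqrt(1 - 4 z), by
  \<open>shifted_central_eq\<close> and \<open>shifted_central_0_mult\<close>.\<close>

definition shifted_central :: "nat \<Rightarrow> real fps" where
  "shifted_central j = Abs_fps (\<lambda>m. real ((2 * m + j) choose m))"

text \<open>Pascal's rule. Powers of the Catalan series obey the same relation, since C = 1 + z C^2
  gives C^(j+1) = C^j + z C^(j+2).\<close>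

lemma shifted_central_rec:
  "shifted_central (Suc j) = shifted_central j + fps_X * shifted_central (Suc (Suc j))"
proof (rule fps_ext)
  fix n show "shifted_central (Suc j) $ n = (shifted_central j + fps_X * shifted_central (Suc (Suc j))) $ n"
    by (cases n) (auto simp: shifted_central_def)
qed

lemma shifted_central_0: "shifted_central 0 = 1 + 2 * fps_X * shifted_central 1"
proof (rule fps_ext)
  fix n
  have "((2 * Suc m) choose Suc m) = 2 * ((2 * m + 1) choose m)" for m
    using binomial_symmetric[of m "2 * m + 1"] by simp
  then show "shifted_central 0 $ n = (1 + 2 * fps_X * shifted_central 1) $ n"
    by (cases n) (auto simp: shifted_central_def numeral_fps_const mult.assoc simp del: binomial_Suc_Suc)
qed

text \<open>The quadratic equation of C makes 1 - 2 z C a square root of 1 - 4 z. In a domain two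
  square roots differ at most in sign, and the constant term 1 selects \<open>H\<close>, the inverse
  of \<open>shifted_central 0\<close>.\<close>

lemma shifted_central_0_mult: "shifted_central 0 * (1 - 2 * fps_X * catalan_fps) = 1"
proof -
  define H where "H = binomial_series (1 / 2) (- 4)"
  define C where "C = catalan_fps"
  have G: "shifted_central 0 = binomial_series (- 1 / 2) (- 4)"
    using gbinomial_neg_half by (simp add: shifted_central_def binomial_series_def)
  have GH: "shifted_central 0 * H = 1"
    unfolding G H_def by (simp add: binomial_series_mult)
  have "H * H = 1 + fps_const (- 4) * fps_X"
    unfolding H_def by (simp add: binomial_series_mult binomial_series_1)
  also have "\<dots> = 1 - 4 * fps_X"
    by (metis fps_const_neg fps_numeral_fps_const mult_minus_left uminus_add_conv_diff add.commute)
  finally have HH: "H * H = 1 - 4 * fps_X" .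
  have C: "C = 1 + fps_X * C * C" unfolding C_def by (rule catalan_fps_rec)
  have "(1 - 2 * fps_X * C) * (1 - 2 * fps_X * C) = 1 - 4 * fps_X * (C - fps_X * C * C)"
    by (simp add: algebra_simps)
  also have "C - fps_X * C * C = 1" using C by (metis add_diff_cancel_right')
  finally have "(1 - 2 * fps_X * C) * (1 - 2 * fps_X * C) = H * H" unfolding HH by simp
  then have "(1 - 2 * fps_X * C = H) \<or> (1 - 2 * fps_X * C = - H)"
    by (simp only: square_eq_iff)
  moreover have "(1 - 2 * fps_X * C) $ 0 = 1" "(- H) $ 0 = - 1"
    by (simp_all add: H_def binomial_series_def)
  ultimately have "1 - 2 * fps_X * C = H" by force
  then show ?thesis using GH C_def by simp
qed

text \<open>Both sides satisfy the recursion \<open>shifted_central_rec\<close>. It is of second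
  order, so the induction carries two consecutive indices; index 1 comes from
  \<open>shifted_central_0\<close> by cancelling 2 z.\<close>

lemma shifted_central_eq: "shifted_central j = catalan_fps ^ j * shifted_central 0"
proof -
  define C where "C = catalan_fps"
  have C: "C = 1 + fps_X * C * C" unfolding C_def by (rule catalan_fps_rec)
  have "shifted_central j = C ^ j * shifted_central 0 \<and>
        shifted_central (Suc j) = C ^ Suc j * shifted_central 0"
  proof (induction j)
    case 0
    have "shifted_central 0 = 1 + 2 * fps_X * C * shifted_central 0"
      using shifted_central_0_mult unfolding C_def by (simp add: algebra_simps)
    then have "2 * fps_X * shifted_central 1 = 2 * fps_X * (C * shifted_central 0)"
      using shifted_central_0 by (metis add_left_cancel mult.assoc)
    then have "shifted_central 1 = C * shifted_central 0" by simp
    then show ?case by simp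
  next
    case (Suc j)
    have "fps_X * shifted_central (Suc (Suc j)) = shifted_central (Suc j) - shifted_central j"
      using shifted_central_rec[of j] by simp
    also have "\<dots> = C ^ j * shifted_central 0 * (C - 1)"
      using Suc by (simp add: algebra_simps)
    also have "C - 1 = fps_X * C * C" using C by (metis add_diff_cancel_left')
    finally have "fps_X * shifted_central (Suc (Suc j)) = fps_X * (C ^ Suc (Suc j) * shifted_central 0)"
      by (simp add: algebra_simps)
    then show ?case using Suc by simp
  qed
  then show ?thesis by (simp add: C_def)
qed

text \<open>Writing Z for z C, the series satisfy F r = [r = k] + Z (F (r + 1) + F 0), with a
  constant value b for r > k. Descending from k to 0 yields F 0 = Z^k + b, and b = Z (b + F 0)
  eliminates b: F 0 (1 - 2 Z) = Z^k (1 - Z).\<close>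

lemma block_sum_indicator:
  assumes "1 \<le> k" "k \<le> n"
  shows "block_sum (\<lambda>i. if i = k then 1 else 0) 0 n = real ((2 * n - k - 1) choose (n - 1))"
proof -
  define f :: "nat \<Rightarrow> real" where "f = (\<lambda>i. if i = k then 1 else 0)"
  define F where "F r = Abs_fps (block_sum f r)" for r
  define C where "C = catalan_fps"
  define Z where "Z = fps_X * C"
  define b where "b = F (Suc k)"
  have rec: "F r = fps_const (f r) + Z * (F (Suc r) + F 0)" for r
    unfolding F_def Z_def C_def by (rule block_sum_fps_rec)
  have "block_sum f (Suc k) = block_sum f (Suc (Suc k))"
    using block_sum_eventually_const[of k f "Suc k"] by (auto simp: f_def)
  then have "F (Suc (Suc k)) = b"
    by (simp add: F_def b_def)
  then have b: "b = Z * (b + F 0)"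
    using rec[of "Suc k"] by (simp add: f_def b_def)
  have Fk: "F k = 1 + b" using rec[of k] b by (simp add: f_def b_def)
  have down: "F (k - i) = Z ^ i + b" if "i \<le> k" for i
    using that
  proof (induction i)
    case (Suc i)
    have "F (k - Suc i) = Z * (F (k - i) + F 0)"
      using rec[of "k - Suc i"] Suc.prems by (simp add: f_def Suc_diff_Suc)
    also have "\<dots> = Z * Z ^ i + Z * (b + F 0)" using Suc by (simp add: algebra_simps)
    finally show ?case using b by simp
  qed (simp add: Fk)
  have F0: "F 0 = Z ^ k + b" using down[of k] by simp
  have C: "C = 1 + Z * C" unfolding Z_def C_def by (rule catalan_fps_rec)
  have C0: "C \<noteq> 0" using C unfolding Z_def
    by (metis add.right_neutral mult_zero_right zero_neq_one)
  have A: "F 0 * (1 - 2 * Z) = Z ^ k * (1 - Z)"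
  proof -
    have bb: "b = F 0 - Z ^ k" using F0 by simp
    show ?thesis using b unfolding bb by (simp add: algebra_simps)
  qed
  \<comment> \<open>Multiplying by C turns 1 - Z into 1 because C (1 - Z) = 1; cancelling C
    afterwards leaves z^k C^(k-1).\<close>
  have "C * (F 0 * (1 - 2 * Z)) = Z ^ k * (C - Z * C)"
    unfolding A by (simp add: algebra_simps)
  also have "C - Z * C = 1" using C by (metis add_diff_cancel_right')
  also have "Z ^ k * 1 = C * (fps_X ^ k * C ^ (k - 1))"
    using assms unfolding Z_def power_mult_distrib
    by (cases k) (auto simp: algebra_simps)
  finally have eq: "F 0 * (1 - 2 * Z) = fps_X ^ k * C ^ (k - 1)" using C0 by simp
  have "F 0 * (shifted_central 0 * (1 - 2 * Z)) = (F 0 * (1 - 2 * Z)) * shifted_central 0"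
    by (simp only: mult.assoc mult.commute mult.left_commute)
  then have "F 0 * (shifted_central 0 * (1 - 2 * Z)) = fps_X ^ k * (C ^ (k - 1) * shifted_central 0)"
    unfolding eq by (simp only: mult.assoc)
  moreover have "shifted_central 0 * (1 - 2 * Z) = 1"
    using shifted_central_0_mult by (simp only: Z_def C_def mult.assoc)
  ultimately have "F 0 = fps_X ^ k * shifted_central (k - 1)"
    by (simp only: C_def mult_1_right flip: shifted_central_eq)
  then have "block_sum f 0 n = (fps_X ^ k * shifted_central (k - 1)) $ n"
    by (metis F_def fps_nth_Abs_fps)
  also have "\<dots> = real ((2 * (n - k) + (k - 1)) choose (n - k))"
    using assms by (simp add: fps_X_power_mult_nth shifted_central_def)
  also have "2 * (n - k) + (k - 1) = 2 * n - k - 1" using assms by simp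
  also have "(2 * n - k - 1) choose (n - k) = (2 * n - k - 1) choose (n - 1)"
    using assms binomial_symmetric[of "n - k" "2 * n - k - 1"]
    by (simp add: algebra_simps)
  finally show ?thesis by (simp add: f_def)
qed

section \<open>Decomposition of noncrossing partitions\<close>

lemma noncrossingD:
  assumes "noncrossing P" "A \<in> P" "B \<in> P" "a \<in> A" "c \<in> A" "b \<in> B" "d \<in> B" "a < b" "b < c" "c < d"
  shows "A = B"
proof (rule ccontr)
  assume "A \<noteq> B"
  then have "A \<noteq> B \<and> (\<exists>a b c d. a < b \<and> b < c \<and> c < d \<and> a \<in> A \<and> c \<in> A \<and> b \<in> B \<and> d \<in> B)"
    using assms(4-10) by (intro conjI exI[of _ a] exI[of _ b] exI[of _ c] exI[of _ d])
  then show False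
    using assms(1-3) unfolding noncrossing_def by (meson bexI)
qed

lemma noncrossingI:
  assumes "\<And>A B a b c d. A \<in> P \<Longrightarrow> B \<in> P \<Longrightarrow> a \<in> A \<Longrightarrow> c \<in> A \<Longrightarrow> b \<in> B \<Longrightarrow> d \<in> B
    \<Longrightarrow> a < b \<Longrightarrow> b < c \<Longrightarrow> c < d \<Longrightarrow> A = B"
  shows "noncrossing P"
  unfolding noncrossing_def by (intro notI) (elim bexE conjE exE, metis assms)

lemma noncrossing_subset:
  assumes Q: "noncrossing Q" and PQ: "P \<subseteq> Q"
  shows "noncrossing P"
proof (rule noncrossingI)
  fix A B a b c d
  assume "A \<in> P" "B \<in> P"
  then have "A \<in> Q" "B \<in> Q" using PQ by blast+
  moreover assume "a \<in> A" "c \<in> A" "b \<in> B" "d \<in> B" "a < b" "b < c" "c < d"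
  ultimately show "A = B" by (rule noncrossingD[OF Q])
qed

lemma partition_on_blocks_eq:
  assumes "partition_on A P" "B \<in> P" "C \<in> P" "x \<in> B" "x \<in> C"
  shows "B = C"
  using assms by (auto simp: partition_on_def disjoint_def)

lemma partition_on_block:
  assumes "partition_on A P" "x \<in> A"
  obtains B where "B \<in> P" "x \<in> B"
  using assms by (auto simp: partition_on_def)

lemma partition_on_block_subset: "partition_on A P \<Longrightarrow> B \<in> P \<Longrightarrow> B \<subseteq> A"
  by (auto simp: partition_on_def)

text \<open>Ground sets are arbitrary because the recursion passes to segments of the ground set,
  and refinements of a partition are treated on each of its blocks.\<close>

definition nc_partitions :: "nat set \<Rightarrow> nat set set set" where
  "nc_partitions A = {P. partition_on A P \<and> noncrossing P}"

lemma NC_eq: "NC n = nc_partitions {1..n}"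
  by (simp add: NC_def nc_partitions_def)

lemma nc_partitions_empty [simp]: "nc_partitions {} = {{}}"
  by (auto simp: nc_partitions_def partition_on_empty noncrossing_def)

lemma finite_nc_partitions: "finite A \<Longrightarrow> finite (nc_partitions A)"
  by (rule finite_subset[of _ "Pow (Pow A)"]) (auto simp: nc_partitions_def partition_on_def)

lemma finite_nc_partition: "finite A \<Longrightarrow> P \<in> nc_partitions A \<Longrightarrow> finite P"
  by (auto simp: nc_partitions_def intro: finite_elements)

definition restrict_partition :: "nat set set \<Rightarrow> nat set \<Rightarrow> nat set set" where
  "restrict_partition P X = (\<inter>) X ` P - {{}}"

lemma restrict_nc_partitions:
  assumes "P \<in> nc_partitions A" "X \<subseteq> A"
  shows "restrict_partition P X \<in> nc_partitions X"
proof -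
  have "partition_on X (restrict_partition P X)"
    using assms partition_on_restrict[of A P X]
    by (simp add: nc_partitions_def restrict_partition_def Int_absorb2)
  moreover have "noncrossing (restrict_partition P X)"
  proof (rule noncrossingI)
    fix B C a b c d
    assume "B \<in> restrict_partition P X" "C \<in> restrict_partition P X"
      "a \<in> B" "c \<in> B" "b \<in> C" "d \<in> C" "a < b" "b < c" "c < d"
    then show "B = C"
      using assms noncrossingD[of P _ _ a c b d]
      by (fastforce simp: restrict_partition_def nc_partitions_def)
  qed
  ultimately show ?thesis by (simp add: nc_partitions_def)
qed

section \<open>Removing the largest point\<close>

definition glue :: "nat \<Rightarrow> nat \<Rightarrow> nat set set \<Rightarrow> nat set set \<Rightarrow> nat set set" where
  "glue j m P Q = (\<lambda>B. if j \<in> B then insert m B else B) ` P \<union> Q"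

text \<open>
  Here \<^term>\<open>m\<close> is the largest point and \<^term>\<open>j\<close> its predecessor within its block. Cutting that
  link leaves two independent noncrossing partitions, of the points up to \<^term>\<open>j\<close> and of those
  strictly between \<^term>\<open>j\<close> and \<^term>\<open>m\<close>.
\<close>

definition linked :: "nat set \<Rightarrow> nat \<Rightarrow> nat \<Rightarrow> nat set set set" where
  "linked A j m = {P \<in> nc_partitions A. \<exists>B\<in>P. j \<in> B \<and> m \<in> B \<and> B \<inter> {j<..<m} = {}}"

context
  fixes A :: "nat set" and m j :: nat
  assumes m: "m \<in> A" "\<forall>x\<in>A. x \<le> m" and j: "j \<in> A" "j < m"
begin

abbreviation (input) "lower_part \<equiv> A \<inter> {..j}"
abbreviation (input) "upper_part \<equiv> A \<inter> {j<..<m}"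

text \<open>A crossing that involves \<open>m\<close> can be moved down to \<open>j\<close>, which
  lies in the same block; and points up to \<open>j\<close>, together with \<open>m\<close>, do not
  cross points strictly between \<open>j\<close> and \<open>m\<close>.\<close>

lemma glue_in_linked:
  assumes P: "P \<in> nc_partitions lower_part" and Q: "Q \<in> nc_partitions upper_part"
  shows "glue j m P Q \<in> linked A j m"
proof -
  have pP: "partition_on lower_part P" and pQ: "partition_on upper_part Q"
    using P Q by (auto simp: nc_partitions_def)
  have subP: "B \<subseteq> lower_part" if "B \<in> P" for B using that pP by (rule partition_on_block_subset[rotated])
  have subQ: "B \<subseteq> upper_part" if "B \<in> Q" for B using that pQ by (rule partition_on_block_subset[rotated])
  obtain B0 where B0: "B0 \<in> P" "j \<in> B0"
    using pP j by (auto elim: partition_on_block)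
  have A: "A = insert m (lower_part \<union> upper_part)" using m j by force
  have "partition_on A (glue j m P Q)"
  proof (rule partition_onI)
    have "\<Union> (glue j m P Q) = insert m (\<Union> P \<union> \<Union> Q)"
      using B0 by (fastforce simp: glue_def split: if_splits)
    then show "\<Union> (glue j m P Q) = A"
      using partition_onD1[OF pP] partition_onD1[OF pQ] A by simp
    show "{} \<notin> glue j m P Q"
      using partition_onD3[OF pP] partition_onD3[OF pQ] by (auto simp: glue_def split: if_splits)
  next
    fix X Y assume XY: "X \<in> glue j m P Q" "Y \<in> glue j m P Q" "X \<noteq> Y"
    let ?f = "\<lambda>B. if j \<in> B then insert m B else B"
    have mP: "m \<notin> B" if "B \<in> P" for B using subP[OF that] j by auto
    have PP: "B = C" if "B \<in> P" "C \<in> P" "x \<in> ?f B" "x \<in> ?f C" for B C x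
    proof (cases "x = m")
      case True
      then have "j \<in> B" "j \<in> C" using that mP by (auto split: if_splits)
      then show ?thesis using partition_on_blocks_eq[OF pP that(1,2)] by simp
    next
      case False
      then have "x \<in> B" "x \<in> C" using that by (auto split: if_splits)
      then show ?thesis using partition_on_blocks_eq[OF pP that(1,2)] by simp
    qed
    have PQ: False if "B \<in> P" "C \<in> Q" "x \<in> ?f B" "x \<in> C" for B C x
    proof -
      have "j < x" "x < m" using subQ[OF that(2)] that(4) by auto
      then show False using subP[OF that(1)] that(3) by (auto split: if_splits)
    qed
    have QQ: "B = C" if "B \<in> Q" "C \<in> Q" "x \<in> B" "x \<in> C" for B C x
      using partition_on_blocks_eq[OF pQ that] .
    show "disjnt X Y"
      unfolding disjnt_iff
    proof (intro allI notI)
      fix x assume x: "x \<in> X \<and> x \<in> Y"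
      consider B C where "B \<in> P" "C \<in> P" "X = ?f B" "Y = ?f C" | "X \<in> Q" "Y \<in> Q"
        | B where "B \<in> P" "X = ?f B" "Y \<in> Q" | C where "C \<in> P" "X \<in> Q" "Y = ?f C"
        using XY unfolding glue_def by blast
      then show False
      proof cases
        case 1
        have "B = C" by (rule PP[OF 1(1,2), of x]) (use x 1(3,4) in simp_all)
        then have "X = Y" unfolding 1(3,4) by (rule arg_cong)
        with XY(3) show False ..
      next
        case 2
        with x QQ[of X Y x] XY(3) show False by simp
      next
        case 3
        with x PQ[of B Y x] show False by simp
      next
        case 4
        with x PQ[of C X x] show False by simp
      qed
    qed
  qed
  moreover have "noncrossing (glue j m P Q)"
  proof (rule noncrossingI)
    fix X Y a b c d
    assume X: "X \<in> glue j m P Q" and Y: "Y \<in> glue j m P Q"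
      and in_blocks: "a \<in> X" "c \<in> X" "b \<in> Y" "d \<in> Y" and less: "a < b" "b < c" "c < d"
    have le_m: "x \<le> m" if "x \<in> X \<union> Y" for x
    proof -
      have "X \<subseteq> insert m A" "Y \<subseteq> insert m A"
        using X Y subP subQ unfolding glue_def by (auto split: if_splits)
      then show ?thesis using that m by auto
    qed
    have abc: "a < m" "b < m" "c < m" using less le_m[of d] in_blocks by auto
    consider B C where "B \<in> P" "C \<in> P" "X = (if j \<in> B then insert m B else B)" "Y = (if j \<in> C then insert m C else C)"
      | "X \<in> Q" "Y \<in> Q" | B where "B \<in> P" "X = (if j \<in> B then insert m B else B)" "Y \<in> Q"
      | C where "C \<in> P" "X \<in> Q" "Y = (if j \<in> C then insert m C else C)"
      using X Y unfolding glue_def by blast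
    then show "X = Y"
    proof cases
      case 1
      have abc': "a \<in> B" "b \<in> C" "c \<in> B"
        using 1 in_blocks abc by (auto split: if_splits)
      have "B = C"
      proof (cases "d = m")
        case False
        then have "d \<in> C" using 1 in_blocks by (auto split: if_splits)
        then show ?thesis using abc' 1 less noncrossingD[of P B C a c b d] P
          by (auto simp: nc_partitions_def)
      next
        \<comment> \<open>Here \<open>m\<close> is the last of the four points, so the block
          \<open>C\<close> contains \<open>j\<close>. Replacing \<open>m\<close> by \<open>j\<close>
          gives a crossing inside \<open>P\<close> if \<open>c < j\<close>; if \<open>c = j\<close>,
          the two blocks already meet.\<close>
        case True
        then have jC: "j \<in> C" using 1 in_blocks subP[of C] j by (auto split: if_splits)
        have "c \<le> j" using abc' subP[of B] 1 by auto
        show ?thesis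
        proof (cases "c = j")
          case True
          then show ?thesis using partition_on_blocks_eq[OF pP, of B C j] 1 abc' jC by simp
        next
          case False
          then show ?thesis using abc' 1 less jC \<open>c \<le> j\<close> noncrossingD[of P B C a c b j] P
            by (auto simp: nc_partitions_def)
        qed
      qed
      then show ?thesis using 1 by simp
    next
      case 2
      then show ?thesis using in_blocks less noncrossingD[of Q X Y a c b d] Q
        by (auto simp: nc_partitions_def)
    next
      case 3
      have "c \<in> B" using 3 in_blocks abc by (auto split: if_splits)
      then show ?thesis using 3 subP[of B] subQ[of Y] in_blocks less by fastforce
    next
      case 4
      have "b \<in> C" using 4 in_blocks abc by (auto split: if_splits)
      then show ?thesis using 4 subP[of C] subQ[of X] in_blocks less by fastforce
    qed
  qed
  moreover have "insert m B0 \<in> glue j m P Q"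
    using B0 by (force simp: glue_def)
  moreover have "insert m B0 \<inter> {j<..<m} = {}"
    using subP[OF B0(1)] by auto
  ultimately show ?thesis
    using B0(2) by (auto simp: linked_def nc_partitions_def intro!: bexI[of _ "insert m B0"])
qed

lemma restrict_glue:
  assumes P: "P \<in> nc_partitions lower_part" and Q: "Q \<in> nc_partitions upper_part"
  shows "restrict_partition (glue j m P Q) lower_part = P"
    and "restrict_partition (glue j m P Q) upper_part = Q"
proof -
  have pP: "partition_on lower_part P" and pQ: "partition_on upper_part Q"
    using P Q by (auto simp: nc_partitions_def)
  have subP: "B \<subseteq> lower_part" if "B \<in> P" for B using that pP by (rule partition_on_block_subset[rotated])
  have subQ: "B \<subseteq> upper_part" if "B \<in> Q" for B using that pQ by (rule partition_on_block_subset[rotated])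
  have LP: "(\<inter>) lower_part ` (\<lambda>B. if j \<in> B then insert m B else B) ` P = P"
  proof -
    have "(\<inter>) lower_part ` (\<lambda>B. if j \<in> B then insert m B else B) ` P = (\<lambda>B. B) ` P"
      unfolding image_image by (rule image_cong) (use subP j in auto)
    then show ?thesis by simp
  qed
  have LQ: "(\<inter>) lower_part ` Q \<subseteq> {{}}" using subQ by fastforce
  show "restrict_partition (glue j m P Q) lower_part = P"
    unfolding restrict_partition_def glue_def image_Un LP
    using LQ partition_onD3[OF pP] by blast
  have RQ: "(\<inter>) upper_part ` Q = Q"
  proof -
    have "(\<inter>) upper_part ` Q = (\<lambda>B. B) ` Q"
      by (rule image_cong) (use subQ in auto)
    then show ?thesis by simp
  qed
  have RP: "(\<inter>) upper_part ` (\<lambda>B. if j \<in> B then insert m B else B) ` P \<subseteq> {{}}"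
  proof -
    have "upper_part \<inter> (if j \<in> B then insert m B else B) = {}" if "B \<in> P" for B
      using subP[OF that] by auto
    then show ?thesis
      unfolding image_image by (intro image_subsetI) (simp only: singleton_iff)
  qed
  show "restrict_partition (glue j m P Q) upper_part = Q"
    unfolding restrict_partition_def glue_def image_Un RQ
    using RP partition_onD3[OF pQ] by blast
qed

text \<open>Every block other than that of \<open>j\<close> and \<open>m\<close> stays on one side
  of \<open>j\<close>: points \<open>y < j < x < m\<close> with \<open>x\<close> and
  \<open>y\<close> in one block would cross the pair \<open>j\<close>, \<open>m\<close>. So cutting
  the link loses no information.\<close>

lemma glue_restrict:
  assumes "P \<in> linked A j m"
  shows "glue j m (restrict_partition P lower_part) (restrict_partition P upper_part) = P"
proof -
  obtain B where B: "B \<in> P" "j \<in> B" "m \<in> B" "B \<inter> {j<..<m} = {}" and P: "P \<in> nc_partitions A"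
    using assms by (auto simp: linked_def)
  have pP: "partition_on A P" using P by (simp add: nc_partitions_def)
  have sub: "C \<subseteq> A" if "C \<in> P" for C using that pP by (rule partition_on_block_subset[rotated])
  have B': "insert m (lower_part \<inter> B) = B" "upper_part \<inter> B = {}"
  proof -
    have B_or: "x \<in> A \<and> (x = m \<or> x \<le> j)" if x: "x \<in> B" for x
    proof -
      have "x \<in> A" using sub[OF B(1)] x by blast
      then have "x \<le> m" using m(2) by blast
      moreover have "x \<notin> {j<..<m}" using B(4) x by blast
      ultimately show ?thesis using \<open>x \<in> A\<close> by auto
    qed
    then show "insert m (lower_part \<inter> B) = B" using B(3) by blast
    show "upper_part \<inter> B = {}" using B(4) by blast
  qed
  have other: "(C \<subseteq> lower_part \<and> j \<notin> C) \<or> C \<subseteq> upper_part" if C: "C \<in> P" "C \<noteq> B" for C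
  proof -
    have jm: "j \<notin> C" "m \<notin> C"
      using C B partition_on_blocks_eq[OF pP] by blast+
    show ?thesis
    proof (rule ccontr)
      assume *: "\<not> ?thesis"
      have "\<not> C \<subseteq> lower_part" "\<not> C \<subseteq> upper_part" using * jm by auto
      then obtain x y where xy: "x \<in> C" "x \<notin> lower_part" "y \<in> C" "y \<notin> upper_part" by blast
      then have x: "x \<in> C" "x > j" using sub[OF C(1)] by auto
      have "y \<le> m" "y \<noteq> m" "y \<noteq> j" using xy jm m(2) sub[OF C(1)] by auto
      then have y: "y \<in> C" "y < j" using xy sub[OF C(1)] by auto
      have "x < m" using x jm m sub[OF C(1)] by (metis le_neq_implies_less subsetD)
      then show False
        using noncrossingD[of P C B y x j m] x y B C P by (auto simp: nc_partitions_def)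
    qed
  qed
  have ne: "{} \<notin> P" using pP by (rule partition_onD3)
  show ?thesis
  proof (intro subset_antisym subsetI)
    fix X assume "X \<in> glue j m (restrict_partition P lower_part) (restrict_partition P upper_part)"
    then consider C where "C \<in> P" "lower_part \<inter> C \<noteq> {}" "X = (if j \<in> lower_part \<inter> C then insert m (lower_part \<inter> C) else lower_part \<inter> C)"
      | C where "C \<in> P" "upper_part \<inter> C \<noteq> {}" "X = upper_part \<inter> C"
      unfolding glue_def restrict_partition_def by blast
    then show "X \<in> P"
    proof cases
      case 1
      show ?thesis
      proof (cases "C = B")
        case True
        then show ?thesis using 1 B B' j by simp
      next
        case False
        then have "C \<subseteq> lower_part" "j \<notin> C" using other[OF 1(1) False] 1(2) by auto
        then have "lower_part \<inter> C = C" by auto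
        then show ?thesis using 1 \<open>j \<notin> C\<close> by simp
      qed
    next
      case 2
      then have "C \<noteq> B" using B' by auto
      then have "C \<subseteq> upper_part" using other[OF 2(1)] 2(2) by auto
      then show ?thesis using 2 by (simp add: Int_absorb1)
    qed
  next
    fix X assume X: "X \<in> P"
    show "X \<in> glue j m (restrict_partition P lower_part) (restrict_partition P upper_part)"
    proof (cases "X = B")
      case True
      then have "lower_part \<inter> B \<in> restrict_partition P lower_part" using X B j by (auto simp: restrict_partition_def)
      moreover have "X = (if j \<in> lower_part \<inter> B then insert m (lower_part \<inter> B) else lower_part \<inter> B)"
        using True B' B j by simp
      ultimately show ?thesis
        unfolding glue_def by (intro UnI1 image_eqI)
    next
      case False
      from other[OF X False] show ?thesis
      proof
        assume *: "X \<subseteq> lower_part \<and> j \<notin> X"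
        then have "lower_part \<inter> X = X" by auto
        then have "X \<in> restrict_partition P lower_part"
          unfolding restrict_partition_def using X ne by (metis DiffI image_eqI singletonD)
        moreover have "X = (if j \<in> X then insert m X else X)" using * by simp
        ultimately show ?thesis unfolding glue_def by (intro UnI1 image_eqI)
      next
        assume "X \<subseteq> upper_part"
        then have "upper_part \<inter> X = X" by auto
        then have "X \<in> restrict_partition P upper_part"
          unfolding restrict_partition_def using X ne by (metis DiffI image_eqI singletonD)
        then show ?thesis by (simp add: glue_def)
      qed
    qed
  qed
qed

lemma sum_linked:
  "(\<Sum>P\<in>linked A j m. h P) = (\<Sum>P\<in>nc_partitions lower_part. \<Sum>Q\<in>nc_partitions upper_part. h (glue j m P Q))"
proof -
  let ?F = "\<lambda>X. glue j m (fst X) (snd X)"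
  let ?G = "\<lambda>P. (restrict_partition P lower_part, restrict_partition P upper_part)"
  have "bij_betw ?F (nc_partitions lower_part \<times> nc_partitions upper_part) (linked A j m)"
  proof (rule bij_betw_byWitness[where f' = ?G])
    show "\<forall>X\<in>nc_partitions lower_part \<times> nc_partitions upper_part. ?G (?F X) = X"
      by (auto simp only: restrict_glue mem_Times_iff fst_conv snd_conv prod.collapse)
    show "\<forall>P\<in>linked A j m. ?F (?G P) = P"
      by (auto simp only: glue_restrict fst_conv snd_conv)
    show "?F ` (nc_partitions lower_part \<times> nc_partitions upper_part) \<subseteq> linked A j m"
      by (intro image_subsetI) (auto simp only: glue_in_linked mem_Times_iff)
    show "?G ` linked A j m \<subseteq> nc_partitions lower_part \<times> nc_partitions upper_part"
      by (intro image_subsetI) (auto simp: linked_def intro: restrict_nc_partitions)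
  qed
  then have "(\<Sum>X\<in>nc_partitions lower_part \<times> nc_partitions upper_part. h (?F X)) = (\<Sum>P\<in>linked A j m. h P)"
    by (rule sum.reindex_bij_betw)
  then show ?thesis
    by (simp only: sum.cartesian_product split_def)
qed

lemma glue_blocks:
  assumes fin: "finite A" and P: "P \<in> nc_partitions lower_part" and Q: "Q \<in> nc_partitions upper_part"
  shows "inj_on (\<lambda>B. if j \<in> B then insert m B else B) P"
    and "(\<lambda>B. if j \<in> B then insert m B else B) ` P \<inter> Q = {}"
    and "\<And>B. B \<in> P \<Longrightarrow> card (if j \<in> B then insert m B else B) = card B + (if j \<in> B then 1 else 0)"
    and "\<And>B. B \<in> P \<Longrightarrow> m \<in> (if j \<in> B then insert m B else B) \<longleftrightarrow> j \<in> B"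
    and "\<And>B. B \<in> Q \<Longrightarrow> m \<notin> B"
proof -
  have pP: "partition_on lower_part P" and pQ: "partition_on upper_part Q"
    using P Q by (auto simp: nc_partitions_def)
  have subP: "B \<subseteq> lower_part" if "B \<in> P" for B using that pP by (rule partition_on_block_subset[rotated])
  have subQ: "B \<subseteq> upper_part" if "B \<in> Q" for B using that pQ by (rule partition_on_block_subset[rotated])
  have mP: "m \<notin> B" if "B \<in> P" for B using subP[OF that] j by auto
  show "inj_on (\<lambda>B. if j \<in> B then insert m B else B) P"
    by (auto simp: inj_on_def mP insert_ident split: if_splits)
  show "(\<lambda>B. if j \<in> B then insert m B else B) ` P \<inter> Q = {}"
  proof -
    have "\<not> (if j \<in> B then insert m B else B) \<subseteq> upper_part" if B: "B \<in> P" for B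
    proof -
      obtain x where "x \<in> B" using partition_onD3[OF pP] B by (metis all_not_in_conv)
      then have "x \<in> (if j \<in> B then insert m B else B)" "x \<notin> upper_part" using subP[OF B] by auto
      then show ?thesis by blast
    qed
    then show ?thesis using subQ by blast
  qed
  show "card (if j \<in> B then insert m B else B) = card B + (if j \<in> B then 1 else 0)" if "B \<in> P" for B
    using mP[OF that] finite_subset[OF subP[OF that]] fin by auto
  show "m \<in> (if j \<in> B then insert m B else B) \<longleftrightarrow> j \<in> B" if "B \<in> P" for B
    using mP[OF that] by auto
  show "m \<notin> B" if "B \<in> Q" for B using subQ[OF that] by auto
qed

end

lemma insert_singleton_nc_partitions:
  assumes "m \<in> A" "\<forall>x\<in>A. x \<le> m"
  shows "bij_betw (insert {m}) (nc_partitions (A - {m})) {P \<in> nc_partitions A. {m} \<in> P}"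
proof (rule bij_betwI[where g = "\<lambda>P. P - {{m}}"])
  have sub: "B \<subseteq> A - {m}" if "P \<in> nc_partitions (A - {m})" "B \<in> P" for P B
    using that partition_on_block_subset by (auto simp: nc_partitions_def)
  show "insert {m} \<in> nc_partitions (A - {m}) \<rightarrow> {P \<in> nc_partitions A. {m} \<in> P}"
  proof
    fix P assume P: "P \<in> nc_partitions (A - {m})"
    have "partition_on A (insert {m} P)"
      using P sub[OF P] assms
      by (subst partition_on_insert) (auto simp: nc_partitions_def disjnt_iff)
    moreover have "noncrossing (insert {m} P)"
    proof (rule noncrossingI)
      fix X Y a b c d
      assume "X \<in> insert {m} P" "Y \<in> insert {m} P" "a \<in> X" "c \<in> X" "b \<in> Y" "d \<in> Y" "a < b" "b < c" "c < d"
      then show "X = Y"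
        using noncrossingD[of P X Y a c b d] P by (auto simp: nc_partitions_def)
    qed
    ultimately show "insert {m} P \<in> {P \<in> nc_partitions A. {m} \<in> P}"
      by (simp add: nc_partitions_def)
  qed
  show "(\<lambda>P. P - {{m}}) \<in> {P \<in> nc_partitions A. {m} \<in> P} \<rightarrow> nc_partitions (A - {m})"
  proof
    fix P assume P: "P \<in> {P \<in> nc_partitions A. {m} \<in> P}"
    then have p: "partition_on A P" "{m} \<in> P" "noncrossing P" by (auto simp: nc_partitions_def)
    have "disjnt {m} (\<Union> (P - {{m}}))"
      using partition_on_blocks_eq[OF p(1) p(2)] by (auto simp: disjnt_iff)
    then have "partition_on (A - {m}) (P - {{m}})"
      using p by (metis insert_Diff partition_on_insert)
    then show "P - {{m}} \<in> nc_partitions (A - {m})"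
      using noncrossing_subset[OF p(3), of "P - {{m}}"] by (simp add: nc_partitions_def)
  qed
  show "insert {m} P - {{m}} = P" if "P \<in> nc_partitions (A - {m})" for P
    using sub[OF that] by fastforce
  show "insert {m} (P - {{m}}) = P" if "P \<in> {P \<in> nc_partitions A. {m} \<in> P}" for P
    using that by auto
qed

lemma nc_partitions_decompose:
  fixes A :: "nat set"
  assumes fin: "finite A" and m: "m \<in> A" "\<forall>x\<in>A. x \<le> m"
  shows "nc_partitions A = {P \<in> nc_partitions A. {m} \<in> P} \<union> (\<Union>j\<in>A - {m}. linked A j m)"
proof (intro subset_antisym subsetI)
  fix P assume P: "P \<in> nc_partitions A"
  then have p: "partition_on A P" by (simp add: nc_partitions_def)
  obtain B where B: "B \<in> P" "m \<in> B" using partition_on_block[OF p m(1)] .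
  have BA: "B \<subseteq> A" using partition_on_block_subset[OF p B(1)] .
  show "P \<in> {P \<in> nc_partitions A. {m} \<in> P} \<union> (\<Union>j\<in>A - {m}. linked A j m)"
  proof (cases "B = {m}")
    case True
    then show ?thesis using P B by simp
  next
    case False
    define j where "j = Max (B - {m})"
    have finB: "finite (B - {m})" using finite_subset[OF BA fin] by simp
    have jB: "j \<in> B - {m}" unfolding j_def using finB False B by (intro Max_in) auto
    have "x \<le> j" if "x \<in> B" "x < m" for x
      unfolding j_def using that finB by (intro Max_ge) auto
    then have "B \<inter> {j<..<m} = {}" by force
    then have "P \<in> linked A j m" using P B jB by (auto simp: linked_def)
    then show ?thesis using jB BA by auto
  qed
qed (auto simp: linked_def)

lemma linked_disjoint:
  assumes "j \<in> A - {m}" "k \<in> A - {m}" "j \<noteq> k" "\<forall>x\<in>A. x \<le> m"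
  shows "linked A j m \<inter> linked A k m = {}"
proof (rule ccontr)
  assume "linked A j m \<inter> linked A k m \<noteq> {}"
  then obtain P B C where P: "partition_on A P" and B: "B \<in> P" "j \<in> B" "m \<in> B" "B \<inter> {j<..<m} = {}"
    and C: "C \<in> P" "k \<in> C" "m \<in> C" "C \<inter> {k<..<m} = {}"
    by (auto simp: linked_def nc_partitions_def)
  have "B = C" using partition_on_blocks_eq[OF P B(1) C(1) B(3) C(3)] .
  moreover have "j < m" "k < m" using assms by (auto simp: le_neq_implies_less)
  ultimately show False using B C assms(3) by (cases j k rule: linorder_cases) auto
qed

lemma sum_nc_partitions:
  fixes A :: "nat set" and h :: "nat set set \<Rightarrow> real"
  assumes fin: "finite A" and m: "m \<in> A" "\<forall>x\<in>A. x \<le> m"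
  shows "(\<Sum>P\<in>nc_partitions A. h P) = (\<Sum>P\<in>nc_partitions (A - {m}). h (insert {m} P))
    + (\<Sum>j\<in>A - {m}. \<Sum>P\<in>nc_partitions (A \<inter> {..j}). \<Sum>Q\<in>nc_partitions (A \<inter> {j<..<m}). h (glue j m P Q))"
proof -
  have fl: "finite (linked A j m)" for j
    using finite_nc_partitions[OF fin] by (simp add: linked_def)
  have single: "{m} \<notin> P" if "P \<in> linked A j m" "j \<noteq> m" for P j
    using that partition_on_blocks_eq[of A P _ "{m}" m]
    by (auto simp: linked_def nc_partitions_def)
  have "(\<Sum>P\<in>nc_partitions A. h P)
     = (\<Sum>P | P \<in> nc_partitions A \<and> {m} \<in> P. h P) + (\<Sum>P\<in>(\<Union>j\<in>A - {m}. linked A j m). h P)"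
    using fin fl single finite_nc_partitions[OF fin]
    by (subst nc_partitions_decompose[OF fin m]) (auto intro!: sum.union_disjoint)
  also have "(\<Sum>P | P \<in> nc_partitions A \<and> {m} \<in> P. h P) = (\<Sum>P\<in>nc_partitions (A - {m}). h (insert {m} P))"
    by (rule sum.reindex_bij_betw[symmetric]) (rule insert_singleton_nc_partitions[OF m])
  also have "(\<Sum>P\<in>(\<Union>j\<in>A - {m}. linked A j m). h P) = (\<Sum>j\<in>A - {m}. \<Sum>P\<in>linked A j m. h P)"
    using fin fl linked_disjoint[OF _ _ _ m(2)] by (intro sum.UNION_disjoint) auto
  also have "\<dots> = (\<Sum>j\<in>A - {m}. \<Sum>P\<in>nc_partitions (A \<inter> {..j}). \<Sum>Q\<in>nc_partitions (A \<inter> {j<..<m}). h (glue j m P Q))"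
  proof (rule sum.cong)
    fix j assume "j \<in> A - {m}"
    then have "j \<in> A" "j < m" using m(2) by auto
    with m show "(\<Sum>P\<in>linked A j m. h P)
      = (\<Sum>P\<in>nc_partitions (A \<inter> {..j}). \<Sum>Q\<in>nc_partitions (A \<inter> {j<..<m}). h (glue j m P Q))"
      by (intro sum_linked)
  qed simp
  finally show ?thesis .
qed


section \<open>Sums over noncrossing partitions as numerical recursions\<close>

lemma bij_betw_rank:
  fixes A :: "nat set"
  assumes "finite A"
  shows "bij_betw (\<lambda>j. card (A \<inter> {..j})) A {1..card A}"
proof -
  have less: "card (A \<inter> {..i}) < card (A \<inter> {..j})" if "i < j" "j \<in> A" for i j
  proof (rule psubset_card_mono)
    have "j \<in> A \<inter> {..j}" "j \<notin> A \<inter> {..i}" using that by auto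
    moreover have "A \<inter> {..i} \<subseteq> A \<inter> {..j}" using that by auto
    ultimately show "A \<inter> {..i} \<subset> A \<inter> {..j}" by blast
  qed (use assms in simp)
  have inj: "inj_on (\<lambda>j. card (A \<inter> {..j})) A"
    using less by (intro linorder_inj_onI) fastforce+
  moreover have "(\<lambda>j. card (A \<inter> {..j})) ` A \<subseteq> {1..card A}"
  proof (rule image_subsetI)
    fix j assume "j \<in> A"
    then have "card (A \<inter> {..j}) > 0" using assms by (subst card_gt_0_iff) auto
    moreover have "card (A \<inter> {..j}) \<le> card A" using assms by (intro card_mono) auto
    ultimately show "card (A \<inter> {..j}) \<in> {1..card A}" by simp
  qed
  ultimately have "(\<lambda>j. card (A \<inter> {..j})) ` A = {1..card A}"
    by (intro card_subset_eq) (auto simp: card_image)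
  with inj show ?thesis by (simp add: bij_betw_def)
qed

text \<open>The terms of the recursion depend on \<open>j\<close> only through the number of points
  up to \<open>j\<close>. Replacing \<open>j\<close> by this rank makes the sum depend on the size
  of \<open>A\<close> alone; \<open>m\<close>, whose rank is \<open>card A\<close>, is left
  out.\<close>

lemma sum_rank:
  fixes A :: "nat set" and f :: "nat \<Rightarrow> real"
  assumes fin: "finite A" and m: "m \<in> A" "\<forall>x\<in>A. x \<le> m"
  shows "(\<Sum>j\<in>A - {m}. f (card (A \<inter> {..j}))) = (\<Sum>i=1..card A - 1. f i)"
proof -
  have "(\<Sum>j\<in>A - {m}. f (card (A \<inter> {..j}))) = (\<Sum>j\<in>A - {m}. f (card ((A - {m}) \<inter> {..j})))"
  proof (rule sum.cong)
    fix j assume "j \<in> A - {m}"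
    then have "j < m" using m(2) by auto
    then have "A \<inter> {..j} = (A - {m}) \<inter> {..j}" by auto
    then show "f (card (A \<inter> {..j})) = f (card ((A - {m}) \<inter> {..j}))" by simp
  qed simp
  also have "\<dots> = (\<Sum>i=1..card (A - {m}). f i)"
    using fin by (intro sum.reindex_bij_betw bij_betw_rank) simp
  finally show ?thesis using fin m by simp
qed

lemma sum_atMost_split_0:
  fixes f :: "nat \<Rightarrow> real"
  shows "(\<Sum>i\<le>n. f i) = f 0 + (\<Sum>i=1..n. f i)"
  by (simp add: atMost_atLeast0 sum.atLeast_Suc_atMost)

context
  fixes A :: "nat set" and m :: nat
  assumes fin: "finite A" and m: "m \<in> A" "\<forall>x\<in>A. x \<le> m"
begin

lemma insert_block:
  assumes "P \<in> nc_partitions (A - {m})"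
  shows "finite P" "{m} \<notin> P" "\<And>B. B \<in> P \<Longrightarrow> m \<notin> B"
proof -
  have sub: "m \<notin> B" if "B \<in> P" for B
    using that assms partition_on_block_subset[of "A - {m}" P B] by (auto simp: nc_partitions_def)
  show "finite P" using finite_nc_partition[OF _ assms] fin by simp
  show "{m} \<notin> P" using sub by blast
  show "\<And>B. B \<in> P \<Longrightarrow> m \<notin> B" by (rule sub)
qed

lemma card_right_part:
  assumes j: "j \<in> A" "j < m"
  shows "card (A \<inter> {j<..<m}) = card A - 1 - card (A \<inter> {..j})"
proof -
  have "A - {m} = A \<inter> {..j} \<union> A \<inter> {j<..<m}"
    using m j by (auto simp: le_neq_implies_less)
  moreover have "card (A \<inter> {..j} \<union> A \<inter> {j<..<m}) = card (A \<inter> {..j}) + card (A \<inter> {j<..<m})"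
    using fin by (intro card_Un_disjoint) auto
  ultimately have "card (A - {m}) = card (A \<inter> {..j}) + card (A \<inter> {j<..<m})" by simp
  then show ?thesis using fin m by simp
qed

lemma Max_left_part: "j \<in> A \<Longrightarrow> Max (A \<inter> {..j}) = j"
  using fin by (intro Max_eqI) auto

lemma prod_insert_block:
  assumes P: "P \<in> nc_partitions (A - {m})"
  shows "(\<Prod>B\<in>insert {m} P. w (card B + (if m \<in> B then r else 0)))
       = (w (Suc r) :: real) * (\<Prod>B\<in>P. w (card B))"
proof -
  note * = insert_block[OF P]
  have "(\<Prod>B\<in>P. w (card B + (if m \<in> B then r else 0))) = (\<Prod>B\<in>P. w (card B))"
    using *(3) by (intro prod.cong) auto
  then show ?thesis using *(1,2) by simp
qed

lemma sum_insert_block: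
  assumes P: "P \<in> nc_partitions (A - {m})"
  shows "(\<Sum>B\<in>insert {m} P. f (card B + (if m \<in> B then r else 0)))
       = (f (Suc r) :: real) + (\<Sum>B\<in>P. f (card B))"
proof -
  note * = insert_block[OF P]
  have "(\<Sum>B\<in>P. f (card B + (if m \<in> B then r else 0))) = (\<Sum>B\<in>P. f (card B))"
    using *(3) by (intro sum.cong) auto
  then show ?thesis using *(1,2) by simp
qed

text \<open>After \<open>m\<close> is removed, its block is that of \<open>j\<close> with one
  element fewer, so the surplus \<open>r\<close> becomes \<open>Suc r\<close>; blocks strictly
  between \<open>j\<close> and \<open>m\<close> are complete and carry no surplus.\<close>

lemma prod_glue:
  assumes j: "j \<in> A" "j < m"
    and P: "P \<in> nc_partitions (A \<inter> {..j})" and Q: "Q \<in> nc_partitions (A \<inter> {j<..<m})"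
  shows "(\<Prod>B\<in>glue j m P Q. w (card B + (if m \<in> B then r else 0)))
       = (\<Prod>B\<in>P. w (card B + (if j \<in> B then Suc r else 0))) * (\<Prod>B\<in>Q. w (card B) :: real)"
proof -
  note * = glue_blocks[OF m j fin P Q]
  have f: "finite P" "finite Q" using finite_nc_partition[OF _ P] finite_nc_partition[OF _ Q] fin by auto
  have "(\<Prod>B\<in>glue j m P Q. w (card B + (if m \<in> B then r else 0)))
     = (\<Prod>B\<in>(\<lambda>B. if j \<in> B then insert m B else B) ` P. w (card B + (if m \<in> B then r else 0)))
      * (\<Prod>B\<in>Q. w (card B + (if m \<in> B then r else 0)))"
    unfolding glue_def using f *(2) by (intro prod.union_disjoint) auto
  also have "(\<Prod>B\<in>Q. w (card B + (if m \<in> B then r else 0))) = (\<Prod>B\<in>Q. w (card B))"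
    using *(5) by (intro prod.cong) auto
  also have "(\<Prod>B\<in>(\<lambda>B. if j \<in> B then insert m B else B) ` P. w (card B + (if m \<in> B then r else 0)))
     = (\<Prod>B\<in>P. w (card B + (if j \<in> B then Suc r else 0)))"
  proof (subst prod.reindex[OF *(1)], unfold o_def, rule prod.cong[OF refl])
    fix B assume B: "B \<in> P"
    show "w (card (if j \<in> B then insert m B else B) + (if m \<in> (if j \<in> B then insert m B else B) then r else 0))
      = w (card B + (if j \<in> B then Suc r else 0))"
      unfolding *(3)[OF B] *(4)[OF B] by simp
  qed
  finally show ?thesis .
qed

lemma sum_glue:
  assumes j: "j \<in> A" "j < m"
    and P: "P \<in> nc_partitions (A \<inter> {..j})" and Q: "Q \<in> nc_partitions (A \<inter> {j<..<m})"
  shows "(\<Sum>B\<in>glue j m P Q. f (card B + (if m \<in> B then r else 0)))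
       = (\<Sum>B\<in>P. f (card B + (if j \<in> B then Suc r else 0))) + (\<Sum>B\<in>Q. f (card B) :: real)"
proof -
  note * = glue_blocks[OF m j fin P Q]
  have fs: "finite P" "finite Q" using finite_nc_partition[OF _ P] finite_nc_partition[OF _ Q] fin by auto
  have "(\<Sum>B\<in>glue j m P Q. f (card B + (if m \<in> B then r else 0)))
     = (\<Sum>B\<in>(\<lambda>B. if j \<in> B then insert m B else B) ` P. f (card B + (if m \<in> B then r else 0)))
      + (\<Sum>B\<in>Q. f (card B + (if m \<in> B then r else 0)))"
    unfolding glue_def using fs *(2) by (intro sum.union_disjoint) auto
  also have "(\<Sum>B\<in>Q. f (card B + (if m \<in> B then r else 0))) = (\<Sum>B\<in>Q. f (card B))"
    using *(5) by (intro sum.cong) auto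
  also have "(\<Sum>B\<in>(\<lambda>B. if j \<in> B then insert m B else B) ` P. f (card B + (if m \<in> B then r else 0)))
     = (\<Sum>B\<in>P. f (card B + (if j \<in> B then Suc r else 0)))"
  proof (subst sum.reindex[OF *(1)], unfold o_def, rule sum.cong[OF refl])
    fix B assume B: "B \<in> P"
    show "f (card (if j \<in> B then insert m B else B) + (if m \<in> (if j \<in> B then insert m B else B) then r else 0))
      = f (card B + (if j \<in> B then Suc r else 0))"
      unfolding *(3)[OF B] *(4)[OF B] by simp
  qed
  finally show ?thesis .
qed

end

text \<open>The surplus \<open>r\<close> must be in the statement for the induction to go through:
  the part up to \<open>j\<close> has \<open>j\<close> as its maximum and is used with
  \<open>Suc r\<close>. An empty ground set has no block to carry a surplus, hence
  \<open>r = 0\<close> there, and \<open>w 0 = 1\<close> matches the empty product.\<close>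

lemma nc_sum_eq_gen:
  assumes w0: "w 0 = 1" and "finite A" "A \<noteq> {} \<or> r = 0"
  shows "(\<Sum>P\<in>nc_partitions A. \<Prod>B\<in>P. w (card B + (if Max A \<in> B then r else 0))) = nc_sum w r (card A)"
  using assms(2,3)
proof (induction "card A" arbitrary: A r rule: less_induct)
  case less
  show ?case
  proof (cases "A = {}")
    case True
    then show ?thesis using less.prems w0 by simp
  next
    case False
    define m where "m = Max A"
    have m: "m \<in> A" "\<forall>x\<in>A. x \<le> m"
      unfolding m_def using less.prems(1) False by auto
    note fin = less.prems(1)
    define k where "k = card A - 1"
    have k: "card A = Suc k"
      using False fin by (simp add: k_def card_gt_0_iff)
    have IH0: "(\<Sum>P\<in>nc_partitions B. \<Prod>C\<in>P. w (card C)) = nc_sum w 0 (card B)"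
      if "B \<subseteq> A - {m}" for B
    proof -
      have "card B < card A" "finite B"
        using that fin m by (auto intro!: psubset_card_mono intro: finite_subset)
      then show ?thesis using less.hyps[of B 0] by simp
    qed
    have "(\<Sum>P\<in>nc_partitions A. \<Prod>B\<in>P. w (card B + (if m \<in> B then r else 0)))
      = (\<Sum>P\<in>nc_partitions (A - {m}). w (Suc r) * (\<Prod>B\<in>P. w (card B)))
       + (\<Sum>j\<in>A - {m}. \<Sum>P\<in>nc_partitions (A \<inter> {..j}). \<Sum>Q\<in>nc_partitions (A \<inter> {j<..<m}).
           (\<Prod>B\<in>P. w (card B + (if j \<in> B then Suc r else 0))) * (\<Prod>B\<in>Q. w (card B)))"
      (is "_ = ?S1 + ?S2")
    proof -
      have "j < m" if "j \<in> A - {m}" for j using m(2) that by auto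
      then show ?thesis
        by (subst sum_nc_partitions[OF fin m])
          (intro arg_cong2[where f = "(+)"] sum.cong[OF refl] prod_insert_block[OF fin m]
            prod_glue[OF fin m]; simp)
    qed
    also have "?S1 = w (Suc r) * nc_sum w 0 k"
      using fin m IH0[of "A - {m}"] by (simp add: k_def flip: sum_distrib_left)
    also have "?S2 = (\<Sum>j\<in>A - {m}. nc_sum w (Suc r) (card (A \<inter> {..j})) * nc_sum w 0 (k - card (A \<inter> {..j})))"
    proof (rule sum.cong)
      fix j assume jA: "j \<in> A - {m}"
      then have j: "j \<in> A" "j < m" using m(2) by auto
      have right: "A \<inter> {j<..<m} \<subseteq> A - {m}" by auto
      have card: "card (A \<inter> {..j}) < card A"
      proof (rule psubset_card_mono[OF fin])
        have "m \<notin> A \<inter> {..j}" using j by simp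
        then show "A \<inter> {..j} \<subset> A" using m(1) by blast
      qed
      have "(\<Sum>P\<in>nc_partitions (A \<inter> {..j}). \<Sum>Q\<in>nc_partitions (A \<inter> {j<..<m}).
           (\<Prod>B\<in>P. w (card B + (if j \<in> B then Suc r else 0))) * (\<Prod>B\<in>Q. w (card B)))
        = (\<Sum>P\<in>nc_partitions (A \<inter> {..j}). \<Prod>B\<in>P. w (card B + (if j \<in> B then Suc r else 0)))
          * (\<Sum>Q\<in>nc_partitions (A \<inter> {j<..<m}). \<Prod>B\<in>Q. w (card B))"
        by (rule sum_product[symmetric])
      also have "(\<Sum>P\<in>nc_partitions (A \<inter> {..j}). \<Prod>B\<in>P. w (card B + (if j \<in> B then Suc r else 0)))
        = nc_sum w (Suc r) (card (A \<inter> {..j}))"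
        using less.hyps[OF card, of "Suc r"] fin j Max_left_part[OF fin m j(1)] by auto
      also have "(\<Sum>Q\<in>nc_partitions (A \<inter> {j<..<m}). \<Prod>B\<in>Q. w (card B)) = nc_sum w 0 (k - card (A \<inter> {..j}))"
        unfolding IH0[OF right] card_right_part[OF fin m j] k_def ..
      finally show "(\<Sum>P\<in>nc_partitions (A \<inter> {..j}). \<Sum>Q\<in>nc_partitions (A \<inter> {j<..<m}).
           (\<Prod>B\<in>P. w (card B + (if j \<in> B then Suc r else 0))) * (\<Prod>B\<in>Q. w (card B)))
        = nc_sum w (Suc r) (card (A \<inter> {..j})) * nc_sum w 0 (k - card (A \<inter> {..j}))" .
    qed simp
    also have "\<dots> = (\<Sum>i=1..k. nc_sum w (Suc r) i * nc_sum w 0 (k - i))"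
      unfolding k_def by (rule sum_rank[OF fin m])
    \<comment> \<open>The singleton block of \<open>m\<close> supplies the missing term
      \<open>i = 0\<close>, since \<open>nc_sum w (Suc r) 0 = w (Suc r)\<close>.\<close>
    also have "w (Suc r) * nc_sum w 0 k + \<dots> = nc_sum w r (Suc k)"
      unfolding nc_sum.simps(2) sum_atMost_split_0 by simp
    finally show ?thesis unfolding m_def k .
  qed
qed

lemma nc_sum_eq:
  assumes "w 0 = 1" "finite A"
  shows "(\<Sum>P\<in>nc_partitions A. \<Prod>B\<in>P. w (card B)) = nc_sum w 0 (card A)"
  using nc_sum_eq_gen[of w A 0] assms by simp

lemma card_nc_partitions: "finite A \<Longrightarrow> real (card (nc_partitions A)) = nc_count (card A)"
  using nc_sum_eq[of "\<lambda>_. 1" A] by simp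

text \<open>The additive analogue of \<open>nc_sum_eq_gen\<close>. Now the empty partition
  contributes an empty sum, which is why \<open>f 0 = 0\<close> replaces
  \<open>w 0 = 1\<close>.\<close>

lemma block_sum_eq_gen:
  assumes f0: "f 0 = 0" and "finite A" "A \<noteq> {} \<or> r = 0"
  shows "(\<Sum>P\<in>nc_partitions A. \<Sum>B\<in>P. f (card B + (if Max A \<in> B then r else 0))) = block_sum f r (card A)"
  using assms(2,3)
proof (induction "card A" arbitrary: A r rule: less_induct)
  case less
  show ?case
  proof (cases "A = {}")
    case True
    then show ?thesis using less.prems f0 by simp
  next
    case False
    define m where "m = Max A"
    have m: "m \<in> A" "\<forall>x\<in>A. x \<le> m"
      unfolding m_def using less.prems(1) False by auto
    note fin = less.prems(1)
    define k where "k = card A - 1"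
    have k: "card A = Suc k"
      using False fin by (simp add: k_def card_gt_0_iff)
    have IH0: "(\<Sum>P\<in>nc_partitions B. \<Sum>C\<in>P. f (card C)) = block_sum f 0 (card B)"
      if "B \<subseteq> A - {m}" for B
    proof -
      have "card B < card A" "finite B"
        using that fin m by (auto intro!: psubset_card_mono intro: finite_subset)
      then show ?thesis using less.hyps[of B 0] by simp
    qed
    have "(\<Sum>P\<in>nc_partitions A. \<Sum>B\<in>P. f (card B + (if m \<in> B then r else 0)))
      = (\<Sum>P\<in>nc_partitions (A - {m}). f (Suc r) + (\<Sum>B\<in>P. f (card B)))
       + (\<Sum>j\<in>A - {m}. \<Sum>P\<in>nc_partitions (A \<inter> {..j}). \<Sum>Q\<in>nc_partitions (A \<inter> {j<..<m}).
           (\<Sum>B\<in>P. f (card B + (if j \<in> B then Suc r else 0))) + (\<Sum>B\<in>Q. f (card B)))"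
      (is "_ = ?S1 + ?S2")
    proof -
      have "j < m" if "j \<in> A - {m}" for j using m(2) that by auto
      then show ?thesis
        by (subst sum_nc_partitions[OF fin m])
          (intro arg_cong2[where f = "(+)"] sum.cong[OF refl] sum_insert_block[OF fin m]
            sum_glue[OF fin m]; simp)
    qed
    also have "?S1 = f (Suc r) * nc_count k + block_sum f 0 k"
      using fin m IH0[of "A - {m}"] card_nc_partitions[of "A - {m}"]
      by (simp add: k_def sum.distrib)
    also have "?S2 = (\<Sum>j\<in>A - {m}. block_sum f (Suc r) (card (A \<inter> {..j})) * nc_count (k - card (A \<inter> {..j}))
       + nc_count (card (A \<inter> {..j})) * block_sum f 0 (k - card (A \<inter> {..j})))"
    proof (rule sum.cong)
      fix j assume jA: "j \<in> A - {m}"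
      then have j: "j \<in> A" "j < m" using m(2) by auto
      have right: "A \<inter> {j<..<m} \<subseteq> A - {m}" by auto
      have card: "card (A \<inter> {..j}) < card A"
      proof (rule psubset_card_mono[OF fin])
        have "m \<notin> A \<inter> {..j}" using j by simp
        then show "A \<inter> {..j} \<subset> A" using m(1) by blast
      qed
      have cR: "card (A \<inter> {j<..<m}) = k - card (A \<inter> {..j})"
        using card_right_part[OF fin m j] by (simp add: k_def)
      have "(\<Sum>P\<in>nc_partitions (A \<inter> {..j}). \<Sum>Q\<in>nc_partitions (A \<inter> {j<..<m}).
           (\<Sum>B\<in>P. f (card B + (if j \<in> B then Suc r else 0))) + (\<Sum>B\<in>Q. f (card B)))
        = (\<Sum>P\<in>nc_partitions (A \<inter> {..j}). \<Sum>B\<in>P. f (card B + (if j \<in> B then Suc r else 0)))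
             * real (card (nc_partitions (A \<inter> {j<..<m})))
          + real (card (nc_partitions (A \<inter> {..j})))
             * (\<Sum>Q\<in>nc_partitions (A \<inter> {j<..<m}). \<Sum>B\<in>Q. f (card B))"
        by (simp only: sum.distrib sum_constant sum_distrib_left mult.commute)
      also have "(\<Sum>P\<in>nc_partitions (A \<inter> {..j}). \<Sum>B\<in>P. f (card B + (if j \<in> B then Suc r else 0)))
        = block_sum f (Suc r) (card (A \<inter> {..j}))"
        using less.hyps[OF card, of "Suc r"] fin j Max_left_part[OF fin m j(1)] by auto
      also have "(\<Sum>Q\<in>nc_partitions (A \<inter> {j<..<m}). \<Sum>B\<in>Q. f (card B)) = block_sum f 0 (k - card (A \<inter> {..j}))"
        unfolding IH0[OF right] cR ..
      finally show "(\<Sum>P\<in>nc_partitions (A \<inter> {..j}). \<Sum>Q\<in>nc_partitions (A \<inter> {j<..<m}).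
           (\<Sum>B\<in>P. f (card B + (if j \<in> B then Suc r else 0))) + (\<Sum>B\<in>Q. f (card B)))
        = block_sum f (Suc r) (card (A \<inter> {..j})) * nc_count (k - card (A \<inter> {..j}))
          + nc_count (card (A \<inter> {..j})) * block_sum f 0 (k - card (A \<inter> {..j}))"
        using fin by (simp only: card_nc_partitions cR finite_Int simp_thms)
    qed simp
    also have "\<dots> = (\<Sum>i=1..k. block_sum f (Suc r) i * nc_count (k - i) + nc_count i * block_sum f 0 (k - i))"
      unfolding k_def by (rule sum_rank[OF fin m])
    also have "f (Suc r) * nc_count k + block_sum f 0 k + \<dots> = block_sum f r (Suc k)"
      unfolding block_sum.simps(2) sum_atMost_split_0 by simp
    finally show ?thesis unfolding m_def k .
  qed
qed

lemma card_blocks_of_size: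
  assumes "1 \<le> k" "k \<le> n"
  shows "(\<Sum>P\<in>NC n. card {B \<in> P. card B = k}) = (2 * n - k - 1) choose (n - 1)"
proof -
  have "real (card {B \<in> P. card B = k}) = (\<Sum>B\<in>P. if card B = k then 1 else 0)" if "P \<in> NC n" for P
    using finite_nc_partition[of "{1..n}" P] that by (simp add: NC_eq Int_def flip: sum.inter_filter)
  then have "real (\<Sum>P\<in>NC n. card {B \<in> P. card B = k})
      = (\<Sum>P\<in>nc_partitions {1..n}. \<Sum>B\<in>P. (\<lambda>i. if i = k then 1 else 0) (card B))"
    unfolding of_nat_sum NC_eq by (intro sum.cong) auto
  also have "\<dots> = block_sum (\<lambda>i. if i = k then 1 else 0) 0 n"
    using block_sum_eq_gen[of "\<lambda>i. if i = k then 1 else 0" "{1..n}" 0] assms by simp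
  also have "\<dots> = real ((2 * n - k - 1) choose (n - 1))"
    by (rule block_sum_indicator[OF assms])
  finally show ?thesis by (simp only: of_nat_eq_iff)
qed

section \<open>Partitions below a given partition\<close>

lemma union_nc_partitions:
  assumes X: "X \<in> nc_partitions A" and g: "\<And>B. B \<in> X \<Longrightarrow> g B \<in> nc_partitions B"
  shows "(\<Union>B\<in>X. g B) \<in> nc_partitions A" "refines A (\<Union>B\<in>X. g B) X"
proof -
  have pX: "partition_on A X" and nX: "noncrossing X" using X by (auto simp: nc_partitions_def)
  have pg: "partition_on B (g B)" and ng: "noncrossing (g B)" if "B \<in> X" for B
    using g[OF that] by (auto simp: nc_partitions_def)
  have sub: "C \<subseteq> B" if "B \<in> X" "C \<in> g B" for B C
    using pg[OF that(1)] that(2) by (rule partition_on_block_subset)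
  have p: "partition_on A (\<Union>B\<in>X. g B)"
  proof (rule partition_onI)
    have "\<Union> (\<Union>B\<in>X. g B) = (\<Union>B\<in>X. \<Union> (g B))" by blast
    also have "\<dots> = (\<Union>B\<in>X. B)"
      by (rule SUP_cong) (simp_all add: partition_onD1[OF pg, symmetric])
    finally show "\<Union> (\<Union>B\<in>X. g B) = A" using partition_onD1[OF pX] by simp
    show "{} \<notin> (\<Union>B\<in>X. g B)" using partition_onD3[OF pg] by blast
  next
    fix C D assume CD: "C \<in> (\<Union>B\<in>X. g B)" "D \<in> (\<Union>B\<in>X. g B)" "C \<noteq> D"
    then obtain B B' where B: "B \<in> X" "C \<in> g B" "B' \<in> X" "D \<in> g B'" by blast
    show "disjnt C D"
      unfolding disjnt_iff
    proof (intro allI notI)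
      fix x assume x: "x \<in> C \<and> x \<in> D"
      then have "x \<in> B" "x \<in> B'" using sub B by blast+
      then have "B = B'" using partition_on_blocks_eq[OF pX B(1,3)] by blast
      then have "C = D" using partition_on_blocks_eq[OF pg[OF B(1)], of C D x] B x by blast
      with CD show False by blast
    qed
  qed
  moreover have "noncrossing (\<Union>B\<in>X. g B)"
  proof (rule noncrossingI)
    fix C D a b c d
    assume CD: "C \<in> (\<Union>B\<in>X. g B)" "D \<in> (\<Union>B\<in>X. g B)"
      and abcd: "a \<in> C" "c \<in> C" "b \<in> D" "d \<in> D" "a < b" "b < c" "c < d"
    then obtain B B' where B: "B \<in> X" "C \<in> g B" "B' \<in> X" "D \<in> g B'" by blast
    have "a \<in> B" "c \<in> B" "b \<in> B'" "d \<in> B'" using sub B abcd by blast+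
    \<comment> \<open>Four crossing points of \<open>C\<close> and \<open>D\<close> also cross in
      the surrounding blocks \<open>B\<close> and \<open>B'\<close>; so these coincide, and the
      crossing would lie inside a single \<open>g B\<close>.\<close>
    then have "B = B'" using noncrossingD[OF nX B(1,3)] abcd by blast
    then show "C = D" using noncrossingD[OF ng[OF B(1)], of C D a c b d] B abcd by blast
  qed
  ultimately show "(\<Union>B\<in>X. g B) \<in> nc_partitions A" by (simp add: nc_partitions_def)
  show "refines A (\<Union>B\<in>X. g B) X"
    unfolding refines_def using p pX sub by blast
qed

text \<open>The interval below \<open>X\<close> is the product of the lattices of its blocks.
  Extensional functions make the choice of one partition per block unique.\<close>

lemma bij_betw_refinements:
  assumes X: "X \<in> nc_partitions A"
  shows "bij_betw (\<lambda>g. \<Union>B\<in>X. g B) (PiE X nc_partitions) {Y \<in> nc_partitions A. refines A Y X}"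
proof (rule bij_betw_byWitness[where f' = "\<lambda>Y. restrict (\<lambda>B. {C \<in> Y. C \<subseteq> B}) X"])
  have pX: "partition_on A X" and nX: "noncrossing X" using X by (auto simp: nc_partitions_def)
  show "\<forall>g\<in>PiE X nc_partitions. restrict (\<lambda>B. {C \<in> (\<Union>B\<in>X. g B). C \<subseteq> B}) X = g"
  proof
    fix g assume g: "g \<in> PiE X nc_partitions"
    have pg: "partition_on B (g B)" if "B \<in> X" for B
      using g that by (auto simp: nc_partitions_def)
    have "{C \<in> (\<Union>B\<in>X. g B). C \<subseteq> B} = g B" if B: "B \<in> X" for B
    proof (intro subset_antisym subsetI)
      fix C assume "C \<in> {C \<in> (\<Union>B\<in>X. g B). C \<subseteq> B}"
      then obtain B' where B': "B' \<in> X" "C \<in> g B'" "C \<subseteq> B" by blast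
      have "C \<noteq> {}" using partition_onD3[OF pg[OF B'(1)]] B'(2) by metis
      then obtain x where "x \<in> C" by blast
      then have "x \<in> B" "x \<in> B'" using B' partition_on_block_subset[OF pg] by blast+
      then have "B = B'" using partition_on_blocks_eq[OF pX B B'(1)] by blast
      then show "C \<in> g B" using B' by simp
    next
      fix C assume "C \<in> g B"
      then show "C \<in> {C \<in> (\<Union>B\<in>X. g B). C \<subseteq> B}"
        using B partition_on_block_subset[OF pg[OF B]] by blast
    qed
    then show "restrict (\<lambda>B. {C \<in> (\<Union>B\<in>X. g B). C \<subseteq> B}) X = g"
      using g by (intro extensionalityI[of _ X]) (auto simp: PiE_def)
  qed
  show "\<forall>Y\<in>{Y \<in> nc_partitions A. refines A Y X}. (\<Union>B\<in>X. restrict (\<lambda>B. {C \<in> Y. C \<subseteq> B}) X B) = Y"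
  proof
    fix Y assume "Y \<in> {Y \<in> nc_partitions A. refines A Y X}"
    then have "\<forall>C\<in>Y. \<exists>B\<in>X. C \<subseteq> B" by (auto simp: refines_def)
    then show "(\<Union>B\<in>X. restrict (\<lambda>B. {C \<in> Y. C \<subseteq> B}) X B) = Y" by auto
  qed
  show "(\<lambda>g. \<Union>B\<in>X. g B) ` PiE X nc_partitions \<subseteq> {Y \<in> nc_partitions A. refines A Y X}"
  proof (rule image_subsetI)
    fix g assume "g \<in> PiE X nc_partitions"
    then have "\<And>B. B \<in> X \<Longrightarrow> g B \<in> nc_partitions B" by auto
    then show "(\<Union>B\<in>X. g B) \<in> {Y \<in> nc_partitions A. refines A Y X}"
      using union_nc_partitions[OF X] by simp
  qed
  show "(\<lambda>Y. restrict (\<lambda>B. {C \<in> Y. C \<subseteq> B}) X) ` {Y \<in> nc_partitions A. refines A Y X} \<subseteq> PiE X nc_partitions"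
  proof (intro image_subsetI restrict_PiE_iff[THEN iffD2] ballI)
    fix Y B assume Y: "Y \<in> {Y \<in> nc_partitions A. refines A Y X}" and B: "B \<in> X"
    then have "partition_on B {C \<in> Y. C \<subseteq> B}" by (intro refines_obtains_subset) auto
    moreover have "noncrossing {C \<in> Y. C \<subseteq> B}"
    proof (rule noncrossing_subset)
      show "noncrossing Y" using Y by (simp add: nc_partitions_def)
    qed blast
    ultimately show "{C \<in> Y. C \<subseteq> B} \<in> nc_partitions B" by (simp add: nc_partitions_def)
  qed
qed

lemma sum_refinements:
  assumes w0: "w 0 = 1" and fin: "finite A" and X: "X \<in> nc_partitions A"
  shows "(\<Sum>Y | Y \<in> nc_partitions A \<and> refines A Y X. \<Prod>C\<in>Y. w (card C)) = (\<Prod>B\<in>X. nc_sum w 0 (card B))"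
proof -
  have pX: "partition_on A X" using X by (simp add: nc_partitions_def)
  have finX: "finite X" using finite_nc_partition[OF fin X] .
  have finB: "finite B" if "B \<in> X" for B
    using partition_on_block_subset[OF pX that] fin finite_subset by blast
  have "(\<Prod>B\<in>X. nc_sum w 0 (card B)) = (\<Prod>B\<in>X. \<Sum>P\<in>nc_partitions B. \<Prod>C\<in>P. w (card C))"
    using nc_sum_eq[of w, OF w0] finB by (intro prod.cong) auto
  also have "\<dots> = (\<Sum>g\<in>PiE X nc_partitions. \<Prod>B\<in>X. \<Prod>C\<in>g B. w (card C))"
    using finX finB finite_nc_partitions by (intro prod_sum_PiE) auto
  also have "\<dots> = (\<Sum>g\<in>PiE X nc_partitions. \<Prod>C\<in>(\<Union>B\<in>X. g B). w (card C))"
  proof (rule sum.cong)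
    fix g assume g: "g \<in> PiE X nc_partitions"
    then have gB: "g B \<in> nc_partitions B" if "B \<in> X" for B using that by auto
    have "g B \<inter> g B' = {}" if B: "B \<in> X" "B' \<in> X" "B \<noteq> B'" for B B'
    proof (rule ccontr)
      assume "g B \<inter> g B' \<noteq> {}"
      then obtain C where C: "C \<in> g B" "C \<in> g B'" by blast
      have p: "partition_on B (g B)" "partition_on B' (g B')"
        using gB B by (auto simp: nc_partitions_def)
      have "C \<noteq> {}" using partition_onD3[OF p(1)] C(1) by metis
      then obtain x where "x \<in> C" by blast
      then have "x \<in> B" "x \<in> B'" using C p partition_on_block_subset by blast+
      then show False using partition_on_blocks_eq[OF pX B(1,2)] B(3) by blast
    qed
    then show "(\<Prod>B\<in>X. \<Prod>C\<in>g B. w (card C)) = (\<Prod>C\<in>(\<Union>B\<in>X. g B). w (card C))"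
      using finX finite_nc_partition[OF finB gB]
      by (intro prod.UNION_disjoint[symmetric]) auto
  qed simp
  also have "\<dots> = (\<Sum>Y | Y \<in> nc_partitions A \<and> refines A Y X. \<Prod>C\<in>Y. w (card C))"
    by (rule sum.reindex_bij_betw[OF bij_betw_refinements[OF X]])
  finally show ?thesis ..
qed

text \<open>The defining property of the Moebius function at the smallest element. Each block of
  \<open>X\<close> contributes a factor that vanishes as soon as the block has two points, so only
  the partition into singletons survives.\<close>

lemma sum_moebius_refinements:
  assumes X: "X \<in> NC n"
  shows "(\<Sum>Y | Y \<in> NC n \<and> refines {1..n} Y X. \<Prod>C\<in>Y. moebius_weight (card C))
       = (if X = singletons n then 1 else 0)"
proof -
  have pX: "partition_on {1..n} X" using X by (simp add: NC_def)
  have finX: "finite X" using finite_elements[OF _ pX] by simp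
  have finB: "finite B" if "B \<in> X" for B
    using partition_on_block_subset[OF pX that] finite_subset by blast
  have "(\<Sum>Y | Y \<in> NC n \<and> refines {1..n} Y X. \<Prod>C\<in>Y. moebius_weight (card C))
      = (\<Prod>B\<in>X. nc_sum moebius_weight 0 (card B))"
    unfolding NC_eq by (rule sum_refinements) (use X in \<open>auto simp: NC_eq moebius_weight_def\<close>)
  also have "\<dots> = (\<Prod>B\<in>X. if card B \<le> 1 then 1 else 0)"
    by (simp only: nc_sum_moebius)
  also have "\<dots> = (if X = singletons n then 1 else 0)"
  proof (cases "X = singletons n")
    case True
    then show ?thesis by (auto simp: singletons_def intro!: prod.neutral)
  next
    case False
    have "\<exists>B\<in>X. \<not> card B \<le> 1"
    proof (rule ccontr)
      assume "\<not> ?thesis"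
      then have le: "\<And>B. B \<in> X \<Longrightarrow> card B \<le> 1" by blast
      have single: "B = {x}" if "B \<in> X" "x \<in> B" for B x
        using le[OF that(1)] that(2) card_le_Suc0_iff_eq[OF finB[OF that(1)]] by auto
      have "X = singletons n"
      proof (intro subset_antisym subsetI)
        fix B assume B: "B \<in> X"
        then have "B \<noteq> {}" using partition_onD3[OF pX] by metis
        then obtain x where x: "x \<in> B" by blast
        then have "x \<in> {1..n}" using partition_on_block_subset[OF pX B] by blast
        then show "B \<in> singletons n" using single[OF B x] by (simp add: singletons_def)
      next
        fix B assume "B \<in> singletons n"
        then obtain i where i: "i \<in> {1..n}" "B = {i}" by (auto simp: singletons_def)
        obtain C where "C \<in> X" "i \<in> C" using partition_on_block[OF pX i(1)] .
        then show "B \<in> X" using single i by metis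
      qed
      with False show False ..
    qed
    then show ?thesis using False finX by (simp add: prod_zero_iff)
  qed
  finally show ?thesis .
qed

section \<open>The Kreweras complement\<close>

text \<open>
  The barred point \<^term>\<open>i\<close> lies between \<^term>\<open>i\<close> and \<^term>\<open>Suc i\<close>. Two barred points may share a block
  iff no chord joining two points of a block of \<^term>\<open>P\<close> separates them; this is visibly an
  equivalence relation, so its classes form the largest admissible partition.
\<close>

definition separates :: "nat \<Rightarrow> nat \<Rightarrow> nat \<Rightarrow> bool" where
  "separates a b i \<longleftrightarrow> (a \<le> i) \<noteq> (b \<le> i)"

text \<open>Since the barred \<open>i\<close> follows the point \<open>i\<close>,
  \<open>a \<le> i\<close> says that it comes after \<open>a\<close>. Thus
  \<open>separates a b i\<close> places the barred \<open>i\<close> between the ends of the chord,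
  and equal truth values for \<open>i\<close> and \<open>j\<close> mean the same side of it.\<close>

definition kreweras_rel :: "nat \<Rightarrow> nat set set \<Rightarrow> (nat \<times> nat) set" where
  "kreweras_rel n P = {(i, j). i \<in> {1..n} \<and> j \<in> {1..n} \<and>
     (\<forall>B\<in>P. \<forall>a\<in>B. \<forall>b\<in>B. separates a b i = separates a b j)}"

lemma equiv_kreweras_rel: "equiv {1..n} (kreweras_rel n P)"
  by (rule equivI) (auto simp: kreweras_rel_def refl_on_def sym_def trans_def)

lemma kreweras_relD:
  assumes "(i, j) \<in> kreweras_rel n P" "B \<in> P" "a \<in> B" "b \<in> B"
  shows "separates a b i = separates a b j"
  using assms unfolding kreweras_rel_def by blast

lemma quotient_kreweras_rel_block:
  assumes "S \<in> {1..n} // kreweras_rel n P" "i \<in> S"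
  shows "j \<in> S \<longleftrightarrow> (i, j) \<in> kreweras_rel n P"
  using assms quotient_eq_iff[OF equiv_kreweras_rel, of S n P S i j]
    in_quotient_imp_closed[OF equiv_kreweras_rel, of S n P i j] by blast

lemma noncrossing_interleave_kreweras:
  assumes P: "P \<in> NC n"
  shows "noncrossing (interleave P ({1..n} // kreweras_rel n P))"
proof (rule noncrossingI)
  let ?K = "{1..n} // kreweras_rel n P"
  have pP: "partition_on {1..n} P" and nP: "noncrossing P" using P by (auto simp: NC_def)
  \<comment> \<open>Positivity makes the truncated subtraction in \<open>2 * i - 1\<close> a true
    one.\<close>
  have pos: "a \<ge> 1" if "B \<in> P" "a \<in> B" for B a
    using partition_on_block_subset[OF pP that(1)] that(2) by auto
  fix X Y x1 y1 x2 y2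
  assume XY: "X \<in> interleave P ?K" "Y \<in> interleave P ?K"
    and in_blocks: "x1 \<in> X" "x2 \<in> X" "y1 \<in> Y" "y2 \<in> Y" and less: "x1 < y1" "y1 < x2" "x2 < y2"
  consider B C where "B \<in> P" "C \<in> P" "X = (\<lambda>i. 2 * i - 1) ` B" "Y = (\<lambda>i. 2 * i - 1) ` C"
    | B C where "B \<in> P" "C \<in> ?K" "X = (\<lambda>i. 2 * i - 1) ` B" "Y = (\<lambda>i. 2 * i) ` C"
    | B C where "B \<in> ?K" "C \<in> P" "X = (\<lambda>i. 2 * i) ` B" "Y = (\<lambda>i. 2 * i - 1) ` C"
    | B C where "B \<in> ?K" "C \<in> ?K" "X = (\<lambda>i. 2 * i) ` B" "Y = (\<lambda>i. 2 * i) ` C"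
    using XY unfolding interleave_def by blast
  then show "X = Y"
  proof cases
    case 1
    obtain a b c d where abcd: "a \<in> B" "c \<in> B" "b \<in> C" "d \<in> C"
      "x1 = 2 * a - 1" "x2 = 2 * c - 1" "y1 = 2 * b - 1" "y2 = 2 * d - 1"
      using in_blocks unfolding 1 by blast
    then have "B = C"
      using noncrossingD[OF nP 1(1,2), of a c b d] less by linarith
    then show ?thesis using 1 by simp
  next
    case 2
    obtain a b c d where abcd: "a \<in> B" "c \<in> B" "b \<in> C" "d \<in> C"
      "x1 = 2 * a - 1" "x2 = 2 * c - 1" "y1 = 2 * b" "y2 = 2 * d"
      using in_blocks unfolding 2 by blast
    have "(b, d) \<in> kreweras_rel n P"
      using quotient_kreweras_rel_block[OF 2(2) abcd(3)] abcd(4) by simp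
    then have "separates a c b = separates a c d"
      by (rule kreweras_relD[OF _ 2(1) abcd(1,2)])
    then have False
      using abcd less pos[OF 2(1)] unfolding separates_def by fastforce
    then show ?thesis ..
  next
    case 3
    obtain a b c d where abcd: "a \<in> B" "c \<in> B" "b \<in> C" "d \<in> C"
      "x1 = 2 * a" "x2 = 2 * c" "y1 = 2 * b - 1" "y2 = 2 * d - 1"
      using in_blocks unfolding 3 by blast
    have "(a, c) \<in> kreweras_rel n P"
      using quotient_kreweras_rel_block[OF 3(1) abcd(1)] abcd(2) by simp
    then have "separates b d a = separates b d c"
      by (rule kreweras_relD[OF _ 3(2) abcd(3,4)])
    then have False
      using abcd less unfolding separates_def by linarith
    then show ?thesis ..
  next
    case 4
    obtain a b c d where abcd: "a \<in> B" "c \<in> B" "b \<in> C" "d \<in> C"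
      "x1 = 2 * a" "x2 = 2 * c" "y1 = 2 * b" "y2 = 2 * d"
      using in_blocks unfolding 4 by blast
    have ac: "(a, c) \<in> kreweras_rel n P"
      using quotient_kreweras_rel_block[OF 4(1) abcd(1)] abcd(2) by simp
    have bd: "(b, d) \<in> kreweras_rel n P"
      using quotient_kreweras_rel_block[OF 4(2) abcd(3)] abcd(4) by simp
    \<comment> \<open>The barred points between \<open>u\<close> and \<open>v\<close> form an
      interval: if it contains \<open>a\<close> and \<open>c\<close>, it contains \<open>b\<close>,
      and if it contains \<open>b\<close> and \<open>d\<close>, it contains \<open>c\<close>. Hence
      a chord that separates neither \<open>a\<close> from \<open>c\<close> nor \<open>b\<close>
      from \<open>d\<close> does not separate \<open>a\<close> from \<open>b\<close>.\<close>
    have "separates u v a = separates u v b" if "D \<in> P" "u \<in> D" "v \<in> D" for D u v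
      using kreweras_relD[OF ac that] kreweras_relD[OF bd that] abcd less
      unfolding separates_def by linarith
    moreover have "a \<in> {1..n}" "b \<in> {1..n}" using ac bd by (auto simp: kreweras_rel_def)
    ultimately have ab: "(a, b) \<in> kreweras_rel n P" unfolding kreweras_rel_def by blast
    have "B = C"
      by (rule quotient_eqI[OF equiv_kreweras_rel 4(1,2) abcd(1,3) ab])
    then show ?thesis using 4 by simp
  qed
qed

text \<open>Two points of one block of \<open>T\<close> on different sides of a chord of
  \<open>P\<close> would produce a crossing in the interleaved partition, so every block of
  \<open>T\<close> lies in one equivalence class.\<close>

lemma refines_kreweras:
  assumes P: "P \<in> NC n" and T: "partition_on {1..n} T" "noncrossing (interleave P T)"
  shows "refines {1..n} T ({1..n} // kreweras_rel n P)"
proof -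
  let ?K = "{1..n} // kreweras_rel n P"
  have pP: "partition_on {1..n} P" using P by (simp add: NC_def)
  have pos: "a \<ge> 1" if "B \<in> P" "a \<in> B" for B a
    using partition_on_block_subset[OF pP that(1)] that(2) by auto
  have no_cross: False if B: "B \<in> P" "a \<in> B" "b \<in> B" and C: "C \<in> T" "i \<in> C" "j \<in> C"
    and less: "a < b" "i < j" and sep: "separates a b i \<noteq> separates a b j" for B C a b i j
  proof -
    let ?B = "(\<lambda>i. 2 * i - 1) ` B" and ?C = "(\<lambda>i. 2 * i) ` C"
    have mem: "?B \<in> interleave P T" "?C \<in> interleave P T"
      using B C unfolding interleave_def by blast+
    have el: "2 * a - 1 \<in> ?B" "2 * b - 1 \<in> ?B" "2 * i \<in> ?C" "2 * j \<in> ?C"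
      using B C by blast+
    have "?B = ?C"
    proof (cases "separates a b i")
      case True
      then have "2 * a - 1 < 2 * i" "2 * i < 2 * b - 1" "2 * b - 1 < 2 * j"
        using sep less pos[OF B(1,2)] pos[OF B(1,3)] unfolding separates_def by linarith+
      then show ?thesis using noncrossingD[OF T(2) mem el(1,2,3,4)] by blast
    next
      case False
      then have "2 * i < 2 * a - 1" "2 * a - 1 < 2 * j" "2 * j < 2 * b - 1"
        using sep less pos[OF B(1,2)] pos[OF B(1,3)] unfolding separates_def by linarith+
      then show ?thesis using noncrossingD[OF T(2) mem(2,1) el(3,4,1,2)] by blast
    qed
    \<comment> \<open>The crossing only forces the two blocks to be equal; parity excludes this, as
      one consists of odd and the other of even numbers.\<close>
    then obtain k where "2 * a - 1 = 2 * k" using el(1) by blast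
    then show False using pos[OF B(1,2)] by presburger
  qed
  have rel: "(i, j) \<in> kreweras_rel n P" if C: "C \<in> T" "i \<in> C" "j \<in> C" for C i j
  proof -
    have "separates a b i = separates a b j" if B: "B \<in> P" "a \<in> B" "b \<in> B" for B a b
    proof (rule ccontr)
      assume sep: "separates a b i \<noteq> separates a b j"
      then have "a \<noteq> b" "i \<noteq> j" by (auto simp: separates_def)
      have sym: "separates b a i = separates a b i" "separates b a j = separates a b j"
        by (auto simp: separates_def)
      show False
        using \<open>a \<noteq> b\<close> \<open>i \<noteq> j\<close> sep sym no_cross[OF B C] no_cross[OF B C(1,3,2)]
          no_cross[OF B(1,3,2) C] no_cross[OF B(1,3,2) C(1,3,2)]
        by (metis linorder_neqE_nat)
    qed
    moreover have "i \<in> {1..n}" "j \<in> {1..n}" using partition_on_block_subset[OF T(1) C(1)] C by auto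
    ultimately show ?thesis unfolding kreweras_rel_def by blast
  qed
  have "\<exists>S\<in>?K. C \<subseteq> S" if C: "C \<in> T" for C
  proof -
    have "C \<noteq> {}" using partition_onD3[OF T(1)] C by metis
    then obtain i where i: "i \<in> C" by blast
    then have "i \<in> {1..n}" using partition_on_block_subset[OF T(1) C] by blast
    then have "kreweras_rel n P `` {i} \<in> ?K" by (rule quotientI)
    moreover have "C \<subseteq> kreweras_rel n P `` {i}" using rel[OF C i] by blast
    ultimately show ?thesis by blast
  qed
  moreover have "partition_on {1..n} ?K" by (rule partition_on_quotient[OF equiv_kreweras_rel])
  ultimately show ?thesis using T(1) by (simp add: refines_def)
qed

lemma kreweras_eq:
  assumes P: "P \<in> NC n"
  shows "kreweras n P = {1..n} // kreweras_rel n P"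
  unfolding kreweras_def
proof (rule the_equality)
  let ?K = "{1..n} // kreweras_rel n P"
  show *: "partition_on {1..n} ?K \<and> noncrossing (interleave P ?K) \<and>
    (\<forall>T. partition_on {1..n} T \<and> noncrossing (interleave P T) \<longrightarrow> refines {1..n} T ?K)"
    using partition_on_quotient[OF equiv_kreweras_rel] noncrossing_interleave_kreweras[OF P]
      refines_kreweras[OF P] by blast
  fix S assume S: "partition_on {1..n} S \<and> noncrossing (interleave P S) \<and>
    (\<forall>T. partition_on {1..n} T \<and> noncrossing (interleave P T) \<longrightarrow> refines {1..n} T S)"
  then have "refines {1..n} S ?K" "refines {1..n} ?K S" using * by blast+
  then show "S = ?K" by (rule refines_asym)
qed

lemma kreweras_in_NC:
  assumes P: "P \<in> NC n"
  shows "kreweras n P \<in> NC n"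
proof -
  let ?K = "{1..n} // kreweras_rel n P"
  have "noncrossing ?K"
  proof (rule noncrossingI)
    fix A B a b c d
    assume AB: "A \<in> ?K" "B \<in> ?K"
      and abcd: "a \<in> A" "c \<in> A" "b \<in> B" "d \<in> B" "a < b" "b < c" "c < d"
    have "(\<lambda>i. 2 * i) ` A = (\<lambda>i. 2 * i) ` B"
    proof (rule noncrossingD[OF noncrossing_interleave_kreweras[OF P]])
      show "(\<lambda>i. 2 * i) ` A \<in> interleave P ?K" "(\<lambda>i. 2 * i) ` B \<in> interleave P ?K"
        using AB unfolding interleave_def by blast+
      show "2 * a \<in> (\<lambda>i. 2 * i) ` A" "2 * c \<in> (\<lambda>i. 2 * i) ` A"
        "2 * b \<in> (\<lambda>i. 2 * i) ` B" "2 * d \<in> (\<lambda>i. 2 * i) ` B" using abcd by blast+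
    qed (use abcd in simp_all)
    then show "A = B" by (subst (asm) inj_image_eq_iff) (auto simp: inj_def)
  qed
  then show ?thesis
    using partition_on_quotient[OF equiv_kreweras_rel] by (simp add: kreweras_eq[OF P] NC_def)
qed

section \<open>Recovering a partition from its complement\<close>

text \<open>
  A block avoiding \<^term>\<open>b\<close> has \<^term>\<open>b\<close> in one of its gaps (cyclically), and the two
  barred points at the ends of that gap lie in the same block of the complement.
\<close>

lemma separating_pair:
  assumes P: "P \<in> NC n" and a: "B \<in> P" "a \<in> B" and b: "b \<in> {1..n}" "b \<notin> B" "a < b"
  obtains i j where "(i, j) \<in> kreweras_rel n P" "separates a b i \<noteq> separates a b j"
proof -
  have pP: "partition_on {1..n} P" and nP: "noncrossing P" using P by (auto simp: NC_def)
  have sub: "C \<subseteq> {1..n}" if "C \<in> P" for C using partition_on_block_subset[OF pP that] .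
  have disj: "C = B" if "C \<in> P" "x \<in> C" "x \<in> B" for C x
    using partition_on_blocks_eq[OF pP that(1) a(1) that(2,3)] .
  have finB: "finite B" using sub[OF a(1)] finite_subset by blast
  define d where "d = Max {x \<in> B. x < b}"
  have d: "d \<in> B" "d < b" "a \<le> d" and d_max: "\<And>x. x \<in> B \<Longrightarrow> x < b \<Longrightarrow> x \<le> d"
  proof -
    have fin: "finite {x \<in> B. x < b}" using finB by simp
    have "d \<in> {x \<in> B. x < b}" unfolding d_def using fin a b by (intro Max_in) auto
    then show "d \<in> B" "d < b" by auto
    show "\<And>x. x \<in> B \<Longrightarrow> x < b \<Longrightarrow> x \<le> d" unfolding d_def using fin by auto
    then show "a \<le> d" using a b by simp
  qed
  have d_range: "d \<in> {1..n}" using d(1) sub[OF a(1)] by blast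
  \<comment> \<open>For \<open>i < j\<close> the points between the barred \<open>i\<close> and the
    barred \<open>j\<close> are those of \<open>{i<..j}\<close>; the two barred points are related
    as soon as this set is a union of blocks, up to points outside the ground set.\<close>
  have relI: "(i, j) \<in> kreweras_rel n P"
    if ij: "i \<in> {1..n}" "j \<in> {1..n}" "i < j"
      and closed: "\<And>C x y. C \<in> P \<Longrightarrow> x \<in> C \<Longrightarrow> y \<in> C \<Longrightarrow> x \<in> {i<..j} \<Longrightarrow> y \<in> {i<..j}" for i j
  proof -
    have "separates x y i = separates x y j" if C: "C \<in> P" "x \<in> C" "y \<in> C" for C x y
    proof -
      have "(i < x \<and> x \<le> j) = (i < y \<and> y \<le> j)"
        using closed[OF C] closed[OF C(1,3,2)] unfolding greaterThanAtMost_iff by blast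
      then show ?thesis using ij(3) unfolding separates_def by presburger
    qed
    then show ?thesis using ij unfolding kreweras_rel_def by blast
  qed
  show thesis
  proof (cases "\<exists>x\<in>B. b < x")
    case True
    define c where "c = Min {x \<in> B. b < x}"
    have fin: "finite {x \<in> B. b < x}" using finB by simp
    have "c \<in> {x \<in> B. b < x}" unfolding c_def using fin True by (intro Min_in) auto
    then have c: "c \<in> B" "b < c" by auto
    have c_min: "\<And>x. x \<in> B \<Longrightarrow> b < x \<Longrightarrow> c \<le> x" unfolding c_def using fin by auto
    \<comment> \<open>The gap of \<open>B\<close> around \<open>b\<close> lies strictly between
      \<open>d\<close> and \<open>c\<close>; the outermost barred points in it are \<open>d\<close>
      and \<open>c - 1\<close>.\<close>
    have "(d, c - 1) \<in> kreweras_rel n P"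
    proof (rule relI)
      show "d \<in> {1..n}" by (rule d_range)
      have "c \<in> {1..n}" using c(1) sub[OF a(1)] by blast
      then show "c - 1 \<in> {1..n}" using c(2) b(1) unfolding atLeastAtMost_iff by arith
      show "d < c - 1" using c(2) d(2) by arith
      fix C x y assume C: "C \<in> P" "x \<in> C" "y \<in> C" and x: "x \<in> {d<..c - 1}"
      have "C \<noteq> B"
      proof
        assume "C = B"
        then have "x \<le> d \<or> c \<le> x" using C d_max[of x] c_min[of x] b by (metis linorder_neqE_nat)
        then show False using x c by auto
      qed
      then have xy: "x \<notin> B" "y \<notin> B" using disj C by blast+
      show "y \<in> {d<..c - 1}"
      proof (rule ccontr)
        assume "y \<notin> {d<..c - 1}"
        then have "y < d \<or> c < y" using xy d c by (cases "y = d"; cases "y = c") auto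
        then show False
        proof
          assume "y < d"
          then have "C = B" using noncrossingD[OF nP C(1) a(1) C(3,2) d(1) c(1)] x c by auto
          then show False using \<open>C \<noteq> B\<close> by simp
        next
          assume "c < y"
          then have "B = C" using noncrossingD[OF nP a(1) C(1) d(1) c(1) C(2,3)] x c by auto
          then show False using \<open>C \<noteq> B\<close> by simp
        qed
      qed
    qed
    moreover have "separates a b d \<noteq> separates a b (c - 1)"
      using d(2,3) c(2) b(3) unfolding separates_def by arith
    ultimately show thesis by (rule that)
  next
    case False
    then have B_le: "x \<le> d" if "x \<in> B" for x
      using that d_max[of x] b by (metis linorder_neqE_nat)
    \<comment> \<open>No point of \<open>B\<close> exceeds \<open>b\<close>, so the gap runs from
      \<open>d\<close> around the circle to the smallest point \<open>e\<close> of \<open>B\<close>.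
      Its complement, the segment from \<open>e\<close> to \<open>d\<close>, is easier to handle: no
      block meets it without lying inside.\<close>
    define e where "e = Min B"
    have e: "e \<in> B" "\<And>x. x \<in> B \<Longrightarrow> e \<le> x"
      unfolding e_def using finB a by (auto intro: Min_in)
    have e_range: "e \<in> {1..n}" using e(1) sub[OF a(1)] by blast
    have inside: "y \<in> {e..d}" if C: "C \<in> P" "x \<in> C" "y \<in> C" and x: "x \<in> {e..d}" for C x y
    proof (cases "C = B")
      case True
      then show ?thesis using e(2)[of y] B_le[of y] C by simp
    next
      case False
      then have xy: "x \<notin> B" "y \<notin> B" using disj C by blast+
      then have x': "e < x" "x < d" using x e(1) d(1) by (auto simp: le_less)
      show ?thesis
      proof (rule ccontr)
        assume "y \<notin> {e..d}"
        then have "y < e \<or> d < y" by auto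
        then show False
        proof
          assume "y < e"
          then have "C = B" using noncrossingD[OF nP C(1) a(1) C(3,2) e(1) d(1)] x' by auto
          then show False using \<open>C \<noteq> B\<close> by simp
        next
          assume "d < y"
          then have "B = C" using noncrossingD[OF nP a(1) C(1) e(1) d(1) C(2,3)] x' by auto
          then show False using \<open>C \<noteq> B\<close> by simp
        qed
      qed
    qed
    \<comment> \<open>The last barred point of the gap precedes \<open>e\<close> on the circle: it
      is \<open>e - 1\<close>, or \<open>n\<close> when \<open>e = 1\<close>.\<close>
    show thesis
    proof (cases "e = 1")
      case True
      have "(d, n) \<in> kreweras_rel n P"
      proof (rule relI)
        show "d \<in> {1..n}" by (rule d_range)
        show "n \<in> {1..n}" "d < n" using b d by auto
        fix C x y assume C: "C \<in> P" "x \<in> C" "y \<in> C" and x: "x \<in> {d<..n}"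
        have "y \<notin> {e..d}" using inside[OF C(1,3,2)] x by auto
        moreover have "y \<in> {1..n}" using sub[OF C(1)] C(3) by blast
        ultimately show "y \<in> {d<..n}" using True by auto
      qed
      moreover have "separates a b d \<noteq> separates a b n"
        using d(2,3) b(1,3) unfolding separates_def atLeastAtMost_iff by arith
      ultimately show thesis by (rule that)
    next
      case False
      have "(e - 1, d) \<in> kreweras_rel n P"
      proof (rule relI)
        show "e - 1 \<in> {1..n}" using False e_range unfolding atLeastAtMost_iff by arith
        show "d \<in> {1..n}" by (rule d_range)
        show "e - 1 < d" using e(2)[OF d(1)] e_range unfolding atLeastAtMost_iff by arith
        fix C x y assume C: "C \<in> P" "x \<in> C" "y \<in> C" and x: "x \<in> {e - 1<..d}"
        then have "x \<in> {e..d}" unfolding atLeastAtMost_iff greaterThanAtMost_iff by arith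
        from inside[OF C this] show "y \<in> {e - 1<..d}"
          using e_range unfolding atLeastAtMost_iff greaterThanAtMost_iff by arith
      qed
      moreover have "separates a b (e - 1) \<noteq> separates a b d"
        using d(2,3) b(3) e(2)[OF a(2)] e_range unfolding separates_def atLeastAtMost_iff by arith
      ultimately show thesis by (rule that)
    qed
  qed
qed

text \<open>The dual of the definition of \<open>kreweras_rel\<close>, with chords and pairs of
  barred points exchanged; it recovers a partition from its complement. As
  \<open>separating_pair\<close> asks for the smaller point in the given block, it is applied to the
  block of \<open>b\<close> when \<open>b < a\<close>.\<close>

lemma kreweras_rel_determines_blocks:
  assumes P: "P \<in> NC n" and B: "B \<in> P" "a \<in> B" and b: "b \<in> {1..n}"
  shows "b \<in> B \<longleftrightarrow> (\<forall>(i, j)\<in>kreweras_rel n P. separates a b i = separates a b j)"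
proof
  assume "b \<in> B"
  then show "\<forall>(i, j)\<in>kreweras_rel n P. separates a b i = separates a b j"
    using kreweras_relD[OF _ B] by blast
next
  assume *: "\<forall>(i, j)\<in>kreweras_rel n P. separates a b i = separates a b j"
  have pP: "partition_on {1..n} P" using P by (simp add: NC_def)
  have a: "a \<in> {1..n}" using partition_on_block_subset[OF pP B(1)] B(2) by blast
  have sym: "separates a b i = separates b a i" for i by (auto simp: separates_def)
  show "b \<in> B"
  proof (rule ccontr)
    assume nb: "b \<notin> B"
    then consider "a < b" | "b < a" using B by (metis linorder_neqE_nat)
    then show False
    proof cases
      case 1
      obtain i j where ij: "(i, j) \<in> kreweras_rel n P" "separates a b i \<noteq> separates a b j"
        by (rule separating_pair[OF P B b nb 1])
      with * show False by blast
    next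
      case 2
      obtain C where C: "C \<in> P" "b \<in> C" using partition_on_block[OF pP b] .
      then have aC: "a \<notin> C" using partition_on_blocks_eq[OF pP C(1) B(1) _ B(2)] nb by blast
      obtain i j where ij: "(i, j) \<in> kreweras_rel n P" "separates b a i \<noteq> separates b a j"
        by (rule separating_pair[OF P C a aC 2])
      from * ij(1) have "separates a b i = separates a b j" by blast
      with ij(2) show False by (simp only: sym)
    qed
  qed
qed

text \<open>A quotient determines its equivalence relation, and this determines the blocks by
  \<open>kreweras_rel_determines_blocks\<close>. As \<open>NC n\<close> is finite, injectivity makes
  the complement a permutation.\<close>

lemma inj_on_kreweras: "inj_on (kreweras n) (NC n)"
proof (rule inj_onI)
  have sub: "P \<subseteq> Q" if PQ: "P \<in> NC n" "Q \<in> NC n" and eq: "kreweras_rel n P = kreweras_rel n Q" for P Q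
  proof
    fix B assume B: "B \<in> P"
    have pP: "partition_on {1..n} P" and pQ: "partition_on {1..n} Q" using PQ by (auto simp: NC_def)
    have "B \<noteq> {}" using partition_onD3[OF pP] B by metis
    then obtain a where a: "a \<in> B" by blast
    have BA: "B \<subseteq> {1..n}" by (rule partition_on_block_subset[OF pP B])
    then obtain C where C: "C \<in> Q" "a \<in> C" using partition_on_block[OF pQ] a by blast
    have CA: "C \<subseteq> {1..n}" by (rule partition_on_block_subset[OF pQ C(1)])
    have "b \<in> B \<longleftrightarrow> b \<in> C" if "b \<in> {1..n}" for b
      using kreweras_rel_determines_blocks[OF PQ(1) B a that]
        kreweras_rel_determines_blocks[OF PQ(2) C that] eq by simp
    then have "B = C" using BA CA by blast
    then show "B \<in> Q" using C by simp
  qed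
  have rel_sub: "kreweras_rel n P \<subseteq> kreweras_rel n Q"
    if eq: "{1..n} // kreweras_rel n P = {1..n} // kreweras_rel n Q" for P Q
  proof (rule subrelI)
    fix i j assume ij: "(i, j) \<in> kreweras_rel n P"
    then have i: "i \<in> {1..n}" by (auto simp: kreweras_rel_def)
    let ?S = "kreweras_rel n P `` {i}"
    have "?S \<in> {1..n} // kreweras_rel n Q" unfolding eq[symmetric] by (rule quotientI[OF i])
    moreover have "i \<in> ?S" by (rule equiv_class_self[OF equiv_kreweras_rel i])
    moreover have "j \<in> ?S" using ij by blast
    ultimately show "(i, j) \<in> kreweras_rel n Q" using quotient_kreweras_rel_block by blast
  qed
  fix P Q assume PQ: "P \<in> NC n" "Q \<in> NC n" "kreweras n P = kreweras n Q"
  then have "{1..n} // kreweras_rel n P = {1..n} // kreweras_rel n Q"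
    by (simp add: kreweras_eq)
  then have "kreweras_rel n P = kreweras_rel n Q"
    using rel_sub[of P Q] rel_sub[of Q P] by blast
  then show "P = Q" using sub[of P Q] sub[of Q P] PQ by blast
qed

lemma bij_betw_kreweras: "bij_betw (kreweras n) (NC n) (NC n)"
  using inj_on_kreweras kreweras_in_NC endo_inj_surj[OF finite_NC, of "kreweras n" n]
  by (auto simp: bij_betw_def)

section \<open>The determinant\<close>

text \<open>The list need not be a linear extension of the order, so the matrix need not be
  triangular. In the Leibniz expansion a permutation with nonzero term moves every index weakly down
  in the order; unless it is the identity, the sum of the sizes of the down-sets would strictly
  decrease, although a permutation preserves it.\<close>

lemma det_zeta_matrix:
  fixes ps :: "'a list" and le :: "'a \<Rightarrow> 'a \<Rightarrow> bool"
  assumes dist: "distinct ps"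
    and refl: "\<And>x. x \<in> set ps \<Longrightarrow> le x x"
    and antisym: "\<And>x y. x \<in> set ps \<Longrightarrow> y \<in> set ps \<Longrightarrow> le x y \<Longrightarrow> le y x \<Longrightarrow> x = y"
    and trans: "\<And>x y z. x \<in> set ps \<Longrightarrow> y \<in> set ps \<Longrightarrow> z \<in> set ps \<Longrightarrow> le x y \<Longrightarrow> le y z \<Longrightarrow> le x z"
  shows "det (mat (length ps) (length ps) (\<lambda>(i, j). if le (ps ! j) (ps ! i) then 1 else 0 :: real)) = 1"
proof -
  let ?N = "length ps"
  let ?Z = "mat ?N ?N (\<lambda>(i, j). if le (ps ! j) (ps ! i) then 1 else 0 :: real)"
  define rk where "rk i = card {y \<in> set ps. le y (ps ! i)}" for i
  have rk_less: "rk i < rk j" if ij: "i < ?N" "j < ?N" "i \<noteq> j" "le (ps ! i) (ps ! j)" for i j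
    unfolding rk_def
  proof (rule psubset_card_mono)
    have mem: "ps ! i \<in> set ps" "ps ! j \<in> set ps" using ij by simp_all
    have "ps ! i \<noteq> ps ! j" using dist ij by (simp add: nth_eq_iff_index_eq)
    then have "\<not> le (ps ! j) (ps ! i)" using antisym[OF mem] ij(4) by blast
    then have "ps ! j \<in> {y \<in> set ps. le y (ps ! j)}" "ps ! j \<notin> {y \<in> set ps. le y (ps ! i)}"
      using refl[OF mem(2)] mem by blast+
    moreover have "{y \<in> set ps. le y (ps ! i)} \<subseteq> {y \<in> set ps. le y (ps ! j)}"
      using trans[OF _ mem] ij(4) by blast
    ultimately show "{y \<in> set ps. le y (ps ! i)} \<subset> {y \<in> set ps. le y (ps ! j)}" by blast
  qed simp
  have zero: "(\<Prod>i = 0..<?N. ?Z $$ (i, p i)) = 0" if p: "p permutes {0..<?N}" "p \<noteq> id" for p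
  proof (rule ccontr)
    assume "(\<Prod>i = 0..<?N. ?Z $$ (i, p i)) \<noteq> 0"
    then have nz: "?Z $$ (i, p i) \<noteq> 0" if "i < ?N" for i
      using that by (simp add: prod_zero_iff)
    have pN: "p i < ?N" if "i < ?N" for i using permutes_in_image[OF p(1), of i] that by simp
    have le: "le (ps ! p i) (ps ! i)" if "i < ?N" for i
      using nz[OF that] pN[OF that] that by (simp split: if_splits)
    have rk_le: "rk (p i) \<le> rk i" if "i < ?N" for i
      using rk_less[OF pN[OF that] that _ le[OF that]] by (cases "p i = i") auto
    obtain k where "p k \<noteq> k" using p(2) by (auto simp: fun_eq_iff)
    moreover from this have k: "k < ?N" using p(1) by (metis permutes_not_in atLeastLessThan_iff zero_le)
    ultimately have "rk (p k) < rk k" using rk_less[OF pN[OF k] k _ le[OF k]] by blast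
    then have "(\<Sum>i\<in>{0..<?N}. rk (p i)) < (\<Sum>i\<in>{0..<?N}. rk i)"
      using rk_le k by (intro sum_strict_mono_ex1) auto
    moreover have "(\<Sum>i\<in>{0..<?N}. rk (p i)) = (\<Sum>i\<in>{0..<?N}. rk i)"
      using sum.permute[OF p(1), of rk] by (simp add: o_def)
    ultimately show False by simp
  qed
  have "det ?Z = (\<Sum>p | p permutes {0..<?N}. signof p * (\<Prod>i = 0..<?N. ?Z $$ (i, p i)))"
    by (rule det_def') simp
  also have "\<dots> = (\<Sum>p\<in>{id}. signof p * (\<Prod>i = 0..<?N. ?Z $$ (i, p i)))"
    using zero by (intro sum.mono_neutral_right) (auto simp: finite_permutations permutes_id)
  also have "\<dots> = 1" using refl by simp
  finally show ?thesis .
qed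

lemma det_meet_matrix:
  fixes ps :: "'a list" and le :: "'a \<Rightarrow> 'a \<Rightarrow> bool" and g :: "'a \<Rightarrow> real"
  assumes dist: "distinct ps"
    and refl: "\<And>x. x \<in> set ps \<Longrightarrow> le x x"
    and antisym: "\<And>x y. x \<in> set ps \<Longrightarrow> y \<in> set ps \<Longrightarrow> le x y \<Longrightarrow> le y x \<Longrightarrow> x = y"
    and trans: "\<And>x y z. x \<in> set ps \<Longrightarrow> y \<in> set ps \<Longrightarrow> z \<in> set ps \<Longrightarrow> le x y \<Longrightarrow> le y z \<Longrightarrow> le x z"
  shows "det (mat (length ps) (length ps)
           (\<lambda>(i, j). \<Sum>y | y \<in> set ps \<and> le y (ps ! i) \<and> le y (ps ! j). g y)) = (\<Prod>y\<in>set ps. g y)"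
proof -
  let ?N = "length ps"
  define Z where "Z = mat ?N ?N (\<lambda>(i, j). if le (ps ! j) (ps ! i) then 1 else 0 :: real)"
  define D where "D = mat ?N ?N (\<lambda>(i, j). if i = j then g (ps ! i) else 0)"
  define ZD where "ZD = mat ?N ?N (\<lambda>(i, j). if le (ps ! j) (ps ! i) then g (ps ! j) else 0)"
  have carr: "Z \<in> carrier_mat ?N ?N" "D \<in> carrier_mat ?N ?N" "ZD \<in> carrier_mat ?N ?N"
    by (simp_all add: Z_def D_def ZD_def)
  have detZ: "det Z = 1" unfolding Z_def by (rule det_zeta_matrix[OF dist refl antisym trans])
  have ZD: "Z * D = ZD"
  proof (rule eq_matI)
    fix i j assume "i < dim_row ZD" "j < dim_col ZD"
    then have ij: "i < ?N" "j < ?N" by (simp_all add: ZD_def)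
    have "(Z * D) $$ (i, j) = (\<Sum>k = 0..<?N. (if le (ps ! k) (ps ! i) then 1 else 0) * (if k = j then g (ps ! k) else 0))"
      using ij by (simp add: Z_def D_def scalar_prod_def)
    also have "\<dots> = (\<Sum>k = 0..<?N. if k = j then (if le (ps ! j) (ps ! i) then g (ps ! j) else 0) else 0)"
      by (rule sum.cong) auto
    finally show "(Z * D) $$ (i, j) = ZD $$ (i, j)" using ij by (simp add: ZD_def)
  qed (simp_all add: Z_def D_def ZD_def)
  have "mat ?N ?N (\<lambda>(i, j). \<Sum>y | y \<in> set ps \<and> le y (ps ! i) \<and> le y (ps ! j). g y) = ZD * Z\<^sup>T"
    (is "?M = _")
  proof (rule eq_matI)
    fix i j assume "i < dim_row (ZD * Z\<^sup>T)" "j < dim_col (ZD * Z\<^sup>T)"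
    then have ij: "i < ?N" "j < ?N" by (simp_all add: Z_def ZD_def)
    have "(ZD * Z\<^sup>T) $$ (i, j) = (\<Sum>k = 0..<?N. (if le (ps ! k) (ps ! i) then g (ps ! k) else 0) * (if le (ps ! k) (ps ! j) then 1 else 0))"
      using ij by (simp add: Z_def ZD_def scalar_prod_def)
    also have "\<dots> = (\<Sum>k = 0..<?N. if le (ps ! k) (ps ! i) \<and> le (ps ! k) (ps ! j) then g (ps ! k) else 0)"
      by (rule sum.cong) auto
    also have "\<dots> = (\<Sum>y\<in>set ps. if le y (ps ! i) \<and> le y (ps ! j) then g y else 0)"
      using sum.reindex_bij_betw[OF bij_betw_nth[OF dist HOL.refl HOL.refl], of "\<lambda>y. if le y (ps ! i) \<and> le y (ps ! j) then g y else 0"]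
      by (simp add: atLeast0LessThan)
    also have "\<dots> = (\<Sum>y | y \<in> set ps \<and> le y (ps ! i) \<and> le y (ps ! j). g y)"
      by (subst sum.inter_filter[symmetric]) auto
    finally show "?M $$ (i, j) = (ZD * Z\<^sup>T) $$ (i, j)" using ij by simp
  qed (simp_all add: Z_def ZD_def)
  then have "det ?M = det (Z * D) * det (Z\<^sup>T)"
    using carr by (simp add: ZD det_mult)
  also have "det (Z * D) = det D" using carr detZ by (simp add: det_mult)
  also have "det (Z\<^sup>T) = 1" using carr detZ by (simp add: det_transpose)
  also have "det D = (\<Prod>y\<in>set ps. g y)"
  proof -
    have "det D = prod_list (diag_mat D)"
      using carr by (intro det_upper_triangular[of _ ?N]) (auto simp: D_def)
    also have "\<dots> = (\<Prod>i = 0..<?N. g (ps ! i))"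
      using carr by (simp add: prod_list_diag_prod D_def)
    also have "\<dots> = (\<Prod>y\<in>set ps. g y)"
      unfolding atLeast0LessThan
      by (rule prod.reindex_bij_betw[OF bij_betw_nth[OF dist HOL.refl HOL.refl]])
    finally show ?thesis .
  qed
  finally show ?thesis by simp
qed

text \<open>The meet is a Hilbert choice of a greatest lower bound, so one has to be exhibited: cut
  every block of \<open>X\<close> by the blocks of \<open>Y\<close>. The result is noncrossing by
  \<open>union_nc_partitions\<close>, and both claims follow from the chosen element being
  greatest.\<close>

lemma meet_NC_lattice:
  assumes X: "X \<in> NC n" and Y: "Y \<in> NC n"
  shows "X \<sqinter>\<^bsub>NC_lattice n\<^esub> Y \<in> NC n"
    and "W \<in> NC n \<Longrightarrow> refines {1..n} W (X \<sqinter>\<^bsub>NC_lattice n\<^esub> Y) \<longleftrightarrow> refines {1..n} W X \<and> refines {1..n} W Y"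
proof -
  let ?A = "{1..n}" and ?L = "NC_lattice n"
  have pX: "partition_on ?A X" and pY: "partition_on ?A Y" using X Y by (auto simp: NC_def)
  define Z where "Z = (\<Union>B\<in>X. restrict_partition Y B)"
  have restr: "restrict_partition Y B \<in> nc_partitions B" if "B \<in> X" for B
    using Y partition_on_block_subset[OF pX that] by (intro restrict_nc_partitions) (auto simp: NC_eq)
  have Z: "Z \<in> NC n" "refines ?A Z X"
    unfolding Z_def NC_eq using union_nc_partitions[of X ?A "restrict_partition Y"] X restr
    by (auto simp: NC_eq)
  have pZ: "partition_on ?A Z" using Z(1) by (simp add: NC_def)
  have "\<exists>C\<in>Y. D \<subseteq> C" if "D \<in> Z" for D
    using that unfolding Z_def restrict_partition_def by blast
  then have ZY: "refines ?A Z Y" using pZ pY by (simp add: refines_def)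
  have greatest: "refines ?A W Z" if W: "refines ?A W X" "refines ?A W Y" for W
  proof -
    have pW: "partition_on ?A W" using W by (simp add: refines_def)
    have "\<exists>E\<in>Z. D \<subseteq> E" if D: "D \<in> W" for D
    proof -
      obtain B C where BC: "B \<in> X" "D \<subseteq> B" "C \<in> Y" "D \<subseteq> C"
        using W D unfolding refines_def by blast
      have "D \<noteq> {}" using partition_onD3[OF pW] D by metis
      then have "B \<inter> C \<in> restrict_partition Y B" using BC unfolding restrict_partition_def by blast
      then have "B \<inter> C \<in> Z" unfolding Z_def by (rule UN_I[OF BC(1)])
      moreover have "D \<subseteq> B \<inter> C" using BC by blast
      ultimately show ?thesis by (rule bexI[rotated])
    qed
    then show ?thesis using pW pZ by (simp add: refines_def)
  qed
  have "greatest ?L Z (Lower ?L {X, Y})"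
    using X Y Z ZY greatest by (auto simp: greatest_def Lower_def NC_lattice_def)
  then have "greatest ?L (X \<sqinter>\<^bsub>?L\<^esub> Y) (Lower ?L {X, Y})"
    unfolding meet_def inf_def by (rule someI)
  then have m: "X \<sqinter>\<^bsub>?L\<^esub> Y \<in> NC n" "refines ?A (X \<sqinter>\<^bsub>?L\<^esub> Y) X" "refines ?A (X \<sqinter>\<^bsub>?L\<^esub> Y) Y"
    "\<And>W. W \<in> NC n \<Longrightarrow> refines ?A W X \<Longrightarrow> refines ?A W Y \<Longrightarrow> refines ?A W (X \<sqinter>\<^bsub>?L\<^esub> Y)"
    using X Y by (auto simp: greatest_def Lower_def NC_lattice_def)
  show "X \<sqinter>\<^bsub>?L\<^esub> Y \<in> NC n" by (rule m(1))
  show "refines ?A W (X \<sqinter>\<^bsub>?L\<^esub> Y) \<longleftrightarrow> refines ?A W X \<and> refines ?A W Y" if "W \<in> NC n"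
    using m(2,3) m(4)[OF that] refines_trans by blast
qed

lemma sum_moebius_common_refinements:
  assumes X: "X \<in> NC n" and Y: "Y \<in> NC n"
  shows "(\<Sum>W | W \<in> NC n \<and> refines {1..n} W X \<and> refines {1..n} W Y. \<Prod>C\<in>W. moebius_weight (card C))
    = (if X \<sqinter>\<^bsub>NC_lattice n\<^esub> Y = singletons n then 1 else 0)"
proof -
  have "{W. W \<in> NC n \<and> refines {1..n} W X \<and> refines {1..n} W Y}
      = {W. W \<in> NC n \<and> refines {1..n} W (X \<sqinter>\<^bsub>NC_lattice n\<^esub> Y)}"
    using meet_NC_lattice(2)[OF X Y] by blast
  then show ?thesis using sum_moebius_refinements[OF meet_NC_lattice(1)[OF X Y]] by simp
qed

lemma permutes_index_map:
  assumes dist: "distinct ps" and f: "bij_betw f (set ps) (set ps)"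
  obtains p where "p permutes {0..<length ps}" "\<And>i. i < length ps \<Longrightarrow> f (ps ! i) = ps ! p i"
proof -
  let ?I = "{0..<length ps}"
  have nth: "bij_betw ((!) ps) ?I (set ps)"
    using dist by (intro bij_betw_nth) (auto simp: atLeast0LessThan)
  define q where "q = inv_into ?I ((!) ps) \<circ> (f \<circ> (!) ps)"
  define p where "p i = (if i \<in> ?I then q i else i)" for i
  have "bij_betw q ?I ?I"
    unfolding q_def by (intro bij_betw_trans[OF bij_betw_trans[OF nth f]] bij_betw_inv_into[OF nth])
  then have "bij_betw p ?I ?I"
    by (rule bij_betw_cong[THEN iffD1, rotated]) (simp add: p_def)
  then have "p permutes ?I"
    by (rule bij_imp_permutes) (simp add: p_def)
  moreover have "f (ps ! i) = ps ! p i" if i: "i < length ps" for i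
  proof -
    have "f (ps ! i) \<in> (!) ps ` ?I"
      using nth f i by (metis bij_betw_apply bij_betw_imp_surj_on nth_mem)
    then have "ps ! inv_into ?I ((!) ps) (f (ps ! i)) = f (ps ! i)" by (rule f_inv_into_f)
    then show ?thesis using i by (simp add: p_def q_def)
  qed
  ultimately show thesis by (rule that)
qed

text \<open>Row \<open>i\<close> of the matrix is row \<open>p i\<close> of \<open>G\<close>, where
  \<open>p\<close> is the permutation of the indices induced by the complement; its sign disappears
  in the absolute value.\<close>

lemma abs_det_M_matrix:
  assumes "distinct ps" and ps: "set ps = NC n"
  shows "\<bar>det (M_matrix n ps)\<bar> = (\<Prod>P\<in>NC n. \<Prod>C\<in>P. \<bar>moebius_weight (card C)\<bar>)"
proof -
  let ?N = "length ps" and ?le = "refines {1..n}"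
  let ?g = "\<lambda>P. \<Prod>C\<in>P. moebius_weight (card C)"
  define G where "G = mat ?N ?N (\<lambda>(i, j). \<Sum>y | y \<in> set ps \<and> ?le y (ps ! i) \<and> ?le y (ps ! j). ?g y)"
  have detG: "det G = (\<Prod>P\<in>NC n. ?g P)"
    unfolding G_def
  proof (subst det_meet_matrix[OF assms(1)])
    show "?le x x" if "x \<in> set ps" for x
      using that by (intro refines_refl) (simp add: ps NC_def)
    show "x = y" if "?le x y" "?le y x" for x y using that by (rule refines_asym)
    show "?le x z" if "?le x y" "?le y z" for x y z using that by (rule refines_trans)
  qed (simp add: ps)
  have "bij_betw (kreweras n) (set ps) (set ps)"
    unfolding ps by (rule bij_betw_kreweras)
  then obtain p where p: "p permutes {0..<?N}" "\<And>i. i < ?N \<Longrightarrow> kreweras n (ps ! i) = ps ! p i"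
    using permutes_index_map[OF assms(1)] by blast
  have pN: "p i < ?N" if "i < ?N" for i using permutes_in_image[OF p(1), of i] that by simp
  have mem: "ps ! i \<in> NC n" if "i < ?N" for i using that ps by (metis nth_mem)
  have "M_matrix n ps = mat ?N ?N (\<lambda>(i, j). G $$ (p i, j))"
  proof (rule eq_matI)
    fix i j assume "i < dim_row (mat ?N ?N (\<lambda>(i, j). G $$ (p i, j)))" "j < dim_col (mat ?N ?N (\<lambda>(i, j). G $$ (p i, j)))"
    then have ij: "i < ?N" "j < ?N" by simp_all
    have "G $$ (p i, j) = (\<Sum>y | y \<in> NC n \<and> ?le y (ps ! p i) \<and> ?le y (ps ! j). ?g y)"
      using ij pN by (simp add: G_def ps)
    also have "\<dots> = M_matrix n ps $$ (i, j)"
      unfolding sum_moebius_common_refinements[OF mem[OF pN[OF ij(1)]] mem[OF ij(2)]]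
      using ij by (simp add: M_matrix_def p(2))
    finally show "M_matrix n ps $$ (i, j) = mat ?N ?N (\<lambda>(i, j). G $$ (p i, j)) $$ (i, j)"
      using ij by simp
  qed (simp_all add: M_matrix_def)
  also have "det \<dots> = signof p * det G"
    by (rule det_permute_rows[OF _ p(1)]) (simp add: G_def)
  finally have "\<bar>det (M_matrix n ps)\<bar> = \<bar>det G\<bar>"
    by (simp add: abs_mult sign_def)
  also have "\<dots> = (\<Prod>P\<in>NC n. \<Prod>C\<in>P. \<bar>moebius_weight (card C)\<bar>)"
    by (simp only: detG abs_prod)
  finally show ?thesis .
qed

theorem theorem4p3:
  fixes n :: nat and ps :: "nat set set list"
  assumes "n \<ge> 2" and "distinct ps" and "set ps = NC n"
  shows "\<bar>det (M_matrix n ps)\<bar> =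
           (\<Prod>k = 2..n. catalan (k - 1) ^ ((2 * n - k - 1) choose (n - 1)))"
proof -
  have block_prod: "(\<Prod>C\<in>P. \<bar>moebius_weight (card C)\<bar>)
      = (\<Prod>k = 1..n. catalan (k - 1) ^ card {C \<in> P. card C = k})" if P: "P \<in> NC n" for P
  proof -
    have pP: "partition_on {1..n} P" using P by (simp add: NC_def)
    have finP: "finite P" using finite_elements[OF _ pP] by simp
    have card: "card C \<in> {1..n}" if C: "C \<in> P" for C
    proof -
      have sub: "C \<subseteq> {1..n}" by (rule partition_on_block_subset[OF pP C])
      have "C \<noteq> {}" using partition_onD3[OF pP] C by metis
      then have "card C > 0" using finite_subset[OF sub] by (simp add: card_gt_0_iff)
      moreover have "card C \<le> n" using card_mono[OF _ sub] by simp
      ultimately show ?thesis by simp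
    qed
    have "(\<Prod>C\<in>P. \<bar>moebius_weight (card C)\<bar>)
        = (\<Prod>k = 1..n. \<Prod>C | C \<in> P \<and> card C = k. \<bar>moebius_weight (card C)\<bar>)"
      using finP card by (intro prod.group[symmetric]) auto
    also have "\<dots> = (\<Prod>k = 1..n. \<Prod>C | C \<in> P \<and> card C = k. catalan (k - 1))"
      by (intro prod.cong) (auto simp: moebius_weight_def abs_mult power_abs less_imp_le[OF catalan_pos])
    finally show ?thesis by simp
  qed
  have "\<bar>det (M_matrix n ps)\<bar> = (\<Prod>P\<in>NC n. \<Prod>k = 1..n. catalan (k - 1) ^ card {C \<in> P. card C = k})"
    unfolding abs_det_M_matrix[OF assms(2,3)] by (rule prod.cong[OF refl block_prod])
  \<comment> \<open>For fixed \<open>k\<close> the exponents now add up, over all partitions, to the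
    total number of blocks of size \<open>k\<close>.\<close>
  also have "\<dots> = (\<Prod>k = 1..n. \<Prod>P\<in>NC n. catalan (k - 1) ^ card {C \<in> P. card C = k})"
    by (rule prod.swap)
  also have "\<dots> = (\<Prod>k = 1..n. catalan (k - 1) ^ ((2 * n - k - 1) choose (n - 1)))"
  proof (rule prod.cong[OF refl])
    fix k assume "k \<in> {1..n}"
    then show "(\<Prod>P\<in>NC n. catalan (k - 1) ^ card {C \<in> P. card C = k})
        = catalan (k - 1) ^ ((2 * n - k - 1) choose (n - 1))"
      using card_blocks_of_size[of k n] by (simp flip: power_sum)
  qed
  \<comment> \<open>The factor for \<open>k = 1\<close> is a power of \<open>catalan 0\<close>,
    which is 1.\<close>
  also have "\<dots> = (\<Prod>k = 2..n. catalan (k - 1) ^ ((2 * n - k - 1) choose (n - 1)))"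
    using assms(1) by (subst prod.atLeast_Suc_atMost) (auto simp: catalan_def numeral_2_eq_2)
  finally show ?thesis .
qed

end
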